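(* Let $n\ge1$. 1. The set of functions in $C(\partial D^n)$ that are holomorphically extendable from one side in the separately continuous sense at no point of $\partial D^n$ is a dense $G_\delta$ subset of $C(\partial D^n)$. 2. The set of functions in $C(\partial D^n)$ that are holomorphically extendable from one side (in the usual sense) at no point of $\partial D^n$ is residual in $C(\partial D^n)$, i.e. it contains a dense $G_\delta$ subset. 3. The set of functions in $C(\partial D^n)$ that are holomorphically extendable from one side in the Lipschitz continuous sense at no point of $\partial D^n$ is a dense $G_\delta$ subset of $C(\partial D^n)$.
   Context: $D$ is the open unit disc in $\mathbb{C}$, $D^n$ the open unit polydisc in $\mathbb{C}^n$ and $\partial D^n$ its full topological boundary. $C(\partial D^n)$ is the Banach space of continuous functions $\partial D^n\to\mathbb{C}$ with the supremum norm. A function $f:\partial D^n\to\mathbb{C}$ is holomorphically extendable from one side (usual sense) at $\zeta\in\partial D^n$ if there are an open neighborhood $U\subseteq\mathbb{C}^n$ of $\zeta$ and a continuous function $F:[U\cap D^n]\cup\partial D^n\to\mathbb{C}$ that is holomorphic on $U\cap D^n$ and agrees with $f$ on $\partial D^n$. In the separately continuous sense, the continuity of $F$ is relaxed to: $F$ is bounded and separately continuous, i.e. continuous in each complex variable when the other variables are fixed. In the Lipschitz continuous sense, the continuity of $F$ is strengthened to Lipschitz continuity of $F$. *)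

theory Defs
  imports "HOL-Complex_Analysis.Complex_Analysis"
begin

definition polydisc :: "(complex ^ 'n) set" where
  "polydisc = {z. \<forall>i. norm (z $ i) < 1}"

text \<open>Elements of this metric space are extensional, that is, \<^const>\<open>undefined\<close>
  outside the boundary, so that they correspond to the functions with domain the boundary.
  Boundedness is automatic because the boundary is compact.\<close>

definition boundary_cfunspace :: "(complex ^ 'n \<Rightarrow> complex) metric" where
  "boundary_cfunspace = cfunspace (top_of_set (frontier polydisc)) euclidean_metric"

text \<open>Holomorphy in several variables, meant for open sets: existence of a complex-linear
  Frechet derivative at every point. In HOL, \<^const>\<open>has_derivative\<close> alone only gives a
  real-linear derivative.\<close>

definition holomorphic_sev_on :: "(complex ^ 'n \<Rightarrow> complex) \<Rightarrow> (complex ^ 'n) set \<Rightarrow> bool" where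
  "holomorphic_sev_on F S \<longleftrightarrow>
    (\<forall>z\<in>S. \<exists>F'. (F has_derivative F') (at z) \<and> (\<forall>c v. F' (c *s v) = c * F' v))"

definition replace_coord :: "complex ^ 'n \<Rightarrow> 'n \<Rightarrow> complex \<Rightarrow> complex ^ 'n" where
  "replace_coord z i w = (\<chi> j. if j = i then w else z $ j)"

definition separately_continuous_on :: "(complex ^ 'n) set \<Rightarrow> (complex ^ 'n \<Rightarrow> complex) \<Rightarrow> bool" where
  "separately_continuous_on S F \<longleftrightarrow>
    (\<forall>z i. continuous_on {w. replace_coord z i w \<in> S} (\<lambda>w. F (replace_coord z i w)))"

text \<open>The parameter \<open>R\<close> is the regularity demanded of the extension
  \<open>F\<close> on its whole domain, which includes the entire boundary of the polydisc and
  not only the part inside \<open>U\<close>.\<close>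

definition one_side_extendable ::
  "((complex ^ 'n) set \<Rightarrow> (complex ^ 'n \<Rightarrow> complex) \<Rightarrow> bool)
    \<Rightarrow> (complex ^ 'n \<Rightarrow> complex) \<Rightarrow> complex ^ 'n \<Rightarrow> bool" where
  "one_side_extendable R f \<zeta> \<longleftrightarrow>
    (\<exists>U F. open U \<and> \<zeta> \<in> U
       \<and> R ((U \<inter> polydisc) \<union> frontier polydisc) F
       \<and> holomorphic_sev_on F (U \<inter> polydisc)
       \<and> (\<forall>z\<in>frontier polydisc. F z = f z))"

definition extendable_usual :: "(complex ^ 'n \<Rightarrow> complex) \<Rightarrow> complex ^ 'n \<Rightarrow> bool" where
  "extendable_usual = one_side_extendable continuous_on"

definition extendable_sep_cont :: "(complex ^ 'n \<Rightarrow> complex) \<Rightarrow> complex ^ 'n \<Rightarrow> bool" where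
  "extendable_sep_cont =
    one_side_extendable (\<lambda>S F. bounded (F ` S) \<and> separately_continuous_on S F)"

definition extendable_lipschitz :: "(complex ^ 'n \<Rightarrow> complex) \<Rightarrow> complex ^ 'n \<Rightarrow> bool" where
  "extendable_lipschitz = one_side_extendable (\<lambda>S F. \<exists>L. L-lipschitz_on S F)"

text \<open>The functions in the space that are extendable, in the sense \<open>E\<close>, at no boundary point.\<close>

definition nowhere_ext ::
  "((complex ^ 'n \<Rightarrow> complex) \<Rightarrow> complex ^ 'n \<Rightarrow> bool) \<Rightarrow> (complex ^ 'n \<Rightarrow> complex) set" where
  "nowhere_ext E = {f \<in> mspace boundary_cfunspace. \<forall>\<zeta>\<in>frontier polydisc. \<not> E f \<zeta>}"

definition dense_gdelta_in :: "'a topology \<Rightarrow> 'a set \<Rightarrow> bool" where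
  "dense_gdelta_in X S \<longleftrightarrow> gdelta_in X S \<and> X closure_of S = topspace X"

definition residual_in :: "'a topology \<Rightarrow> 'a set \<Rightarrow> bool" where
  "residual_in X S \<longleftrightarrow> S \<subseteq> topspace X \<and> (\<exists>T \<subseteq> S. dense_gdelta_in X T)"

lemma compact_frontier_polydisc: "compact (frontier (polydisc :: (complex ^ 'n) set))"
proof -
  have "norm z \<le> real CARD('n)" if "z \<in> polydisc" for z :: "complex ^ 'n"
  proof -
    have "norm z \<le> (\<Sum>i\<in>UNIV. norm (z $ i))"
      unfolding norm_vec_def by (rule L2_set_le_sum) simp
    also have "\<dots> \<le> (\<Sum>i\<in>(UNIV::'n set). 1)"
      using that by (intro sum_mono) (auto simp: polydisc_def less_imp_le)
    finally show ?thesis by simp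
  qed
  then have "bounded (polydisc :: (complex ^ 'n) set)"
    by (auto simp: bounded_iff)
  then show ?thesis
    by (rule compact_frontier_bounded)
qed

lemma mspace_boundary_cfunspace:
  "mspace (boundary_cfunspace :: (complex ^ 'n \<Rightarrow> complex) metric) =
    {f. f \<in> extensional (frontier polydisc) \<and> continuous_on (frontier polydisc) f}"
proof -
  have "bounded (f ` frontier polydisc)" if "continuous_on (frontier polydisc) f"
    for f :: "complex ^ 'n \<Rightarrow> complex"
    using compact_continuous_image[OF that compact_frontier_polydisc] compact_imp_bounded by blast
  then show ?thesis
    by (auto simp: boundary_cfunspace_def)
qed

end

theory Submission
  imports Defs
begin

text \<open>Fix a boundary point \<open>b\<close> with \<open>\<bar>b\<^sub>i\<bar> = 1\<close> and all other coordinates inside the disc, and a small box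
  around it: \<open>z\<^sub>i\<close> ranges over a lune of the disc cut off by a chord near \<open>b\<^sub>i\<close>, the other coordinates
  over small discs inside the unit disc. Consider the functions \<open>f\<close> on the boundary that have on this
  box a holomorphic extension \<open>F\<close>, bounded by \<open>M\<close> and continuous up to the boundary in the
  variable \<open>z\<^sub>i\<close>. Boxes form a basis at the boundary, in the sense that every neighbourhood of every
  boundary point contains the inner part of one, and countably many boxes suffice. Hence the functions
  that are extendable at some point in the separately continuous sense form the union of the countably
  many sets belonging to these boxes and to the natural numbers \<open>M\<close>; here one inclusion holds by
  restriction and the other is \<open>box_extension_imp_extendable_sep_cont\<close>. By Baire's theorem the first claim
  follows once each of these sets is closed and has empty interior.

  Closedness rests on a two-constants estimate (\<open>two_constants_lune\<close>, with its corollary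
  \<open>small_on_arc_imp_small\<close>): a holomorphic function on a lune that is bounded by \<open>M\<close> and very small on
  the arc is small on every smaller lune. Applied to the slices in direction \<open>i\<close>, it turns uniform
  convergence of boundary functions into locally uniform convergence of the extensions, up to the
  boundary face (\<open>box_extension_limit\<close>); this takes the place of a normal family argument. Cauchy
  estimates show that the limit is again holomorphic (\<open>holomorphic_sev_on_uniform_limit\<close>).

  The interior is empty because extendable functions form a vector space: if all functions near \<open>f\<close>
  were extendable to the box, then so would be every small multiple of the function
  \<open>max 0 (s - b\<^sub>i \<bullet> z\<^sub>i)\<close>. This function vanishes on an arc around \<open>b\<^sub>i\<close> but not on the whole arc of the
  lune, which contradicts the uniqueness theorem for boundary values (\<open>kink_not_boundary_value\<close>).

  An extension in the usual sense is locally bounded and separately continuous, and a Lipschitz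
  extension is continuous. So the dense \<open>G\<^sub>\<delta>\<close> set of the first claim is contained in the sets of the
  other two. In the Lipschitz case the limits of the extensions inherit the Lipschitz constant, so the
  corresponding sets are closed as well and the third set is itself a \<open>G\<^sub>\<delta>\<close>.\<close>

section \<open>A two-constants estimate in lunes of the disc\<close>

definition open_lune :: "complex \<Rightarrow> real \<Rightarrow> complex set" where
  "open_lune a c = {w. norm w < 1 \<and> c < a \<bullet> w}"

text \<open>Only the circular part of the boundary is added to the lune, without the chord and the corners: this
  is where the boundary values of an extension are attained continuously.\<close>

definition lune_with_arc :: "complex \<Rightarrow> real \<Rightarrow> complex set" where
  "lune_with_arc a c = {w. norm w \<le> 1 \<and> c < a \<bullet> w}"

lemma open_open_lune: "open (open_lune a c)"
proof -
  have "open_lune a c = ball 0 1 \<inter> {w. a \<bullet> w > c}"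
    by (auto simp: open_lune_def)
  then show ?thesis
    by (simp add: open_Int open_halfspace_gt)
qed

lemma convex_open_lune: "convex (open_lune a c)"
proof -
  have "open_lune a c = ball 0 1 \<inter> {w. a \<bullet> w > c}"
    by (auto simp: open_lune_def)
  then show ?thesis
    by (simp add: convex_Int convex_halfspace_gt)
qed

text \<open>The maximum principle is applied to \<open>g w * exp (\<mu> * (cnj a * w - s))\<close> on the smaller closed lune
  \<open>a \<bullet> w \<ge> s\<close>. The exponential factor has modulus one on the chord, where only the bound \<open>M\<close> is known,
  and at most \<open>exp (\<mu> * (1 - s))\<close> on the arc, where the better bound \<open>\<epsilon>\<close> can absorb it. Inside
  the lune the factor is large, which gives the gain.\<close>

lemma two_constants_lune:
  assumes a: "norm a = 1" and "c < s"
    and cont: "continuous_on (lune_with_arc a c) g" and hol: "g holomorphic_on open_lune a c"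
    and M: "\<And>w. w \<in> open_lune a c \<Longrightarrow> norm (g w) \<le> M"
    and \<epsilon>: "\<And>w. \<lbrakk>norm w = 1; c < a \<bullet> w\<rbrakk> \<Longrightarrow> norm (g w) \<le> \<epsilon>"
    and "0 \<le> \<mu>" and z: "norm z \<le> 1" "s \<le> a \<bullet> z"
  shows "norm (g z) \<le> max M (\<epsilon> * exp (\<mu> * (1 - s))) * exp (- \<mu> * (a \<bullet> z - s))"
proof -
  define S where "S = cball 0 1 \<inter> {w. a \<bullet> w \<ge> s}"
  define G where "G w = g w * exp (of_real \<mu> * (cnj a * w - of_real s))" for w
  have Re: "Re (cnj a * w) = a \<bullet> w" for w
    by (simp add: inner_complex_def)
  have normG: "norm (G w) = norm (g w) * exp (\<mu> * (a \<bullet> w - s))" for w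
    by (simp add: G_def norm_mult flip: Re)
  have "a \<noteq> 0" using a by auto
  then have intS: "interior S = ball 0 1 \<inter> {w. a \<bullet> w > s}"
    by (simp add: S_def interior_halfspace_ge)
  have "closed S"
    by (simp add: S_def closed_Int closed_halfspace_ge)
  have S_sub: "S \<subseteq> lune_with_arc a c" "interior S \<subseteq> open_lune a c"
    unfolding intS using \<open>c < s\<close> by (auto simp: S_def lune_with_arc_def open_lune_def)
  have "norm (G z) \<le> max M (\<epsilon> * exp (\<mu> * (1 - s)))"
  proof (rule maximum_modulus_frontier[where f = G and S = S])
    have "g holomorphic_on interior S"
      using hol S_sub(2) by (rule holomorphic_on_subset)
    then show "G holomorphic_on interior S"
      unfolding G_def by (intro holomorphic_intros)
    show "continuous_on (closure S) G"
      unfolding G_def closure_closed[OF \<open>closed S\<close>]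
      by (intro continuous_intros continuous_on_subset[OF cont S_sub(1)])
    show "bounded S"
      by (simp add: S_def bounded_Int)
    show "z \<in> S"
      using z by (simp add: S_def)
    fix w assume "w \<in> frontier S"
    then have w: "w \<in> S" "w \<notin> interior S"
      using \<open>closed S\<close> by (auto simp: frontier_def)
    have "a \<bullet> w \<le> norm a * norm w"
      by (rule norm_cauchy_schwarz)
    then have aw: "a \<bullet> w \<le> 1"
      using w a by (simp add: S_def)
    show "norm (G w) \<le> max M (\<epsilon> * exp (\<mu> * (1 - s)))"
    proof (cases "norm w = 1")
      case True
      then have "norm (g w) \<le> \<epsilon>"
        using \<epsilon> w \<open>c < s\<close> by (auto simp: S_def)
      then have "norm (G w) \<le> \<epsilon> * exp (\<mu> * (1 - s))"
        unfolding normG using aw \<open>0 \<le> \<mu>\<close> order_trans[OF norm_ge_zero]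
        by (intro mult_mono) (auto intro!: mult_left_mono)
      then show ?thesis by simp
    next
      case False
      then have "norm w < 1" "a \<bullet> w = s"
        using w(1) w(2)[unfolded intS] by (auto simp: S_def)
      then have "norm (G w) \<le> M"
        using M[of w] \<open>c < s\<close> by (simp add: normG open_lune_def)
      then show ?thesis by simp
    qed
  qed
  moreover have "norm (g z) = norm (G z) * exp (- \<mu> * (a \<bullet> z - s))"
    by (simp add: normG mult.assoc flip: exp_add)
  ultimately show ?thesis
    by (simp only: mult_right_mono exp_ge_zero)
qed

text \<open>In the two-constants estimate, \<open>\<mu>\<close> is chosen first, so large that the exponential gain beats \<open>M\<close>
  on the part of the lune where \<open>s \<le> a \<bullet> w\<close>, measured from the chord \<open>a \<bullet> w = s'\<close> halfway
  between \<open>c\<close> and \<open>s\<close>; then \<open>\<delta>\<close> is chosen so small that its growth by the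
  factor \<open>exp (\<mu> * (1 - s'))\<close> is harmless. The number \<open>\<delta>\<close> is the same for all \<open>g\<close>, which is what
  makes families of extensions converge uniformly.\<close>

lemma small_on_arc_imp_small:
  fixes a :: complex
  assumes a: "norm a = 1" and "c < s" and "0 < \<eta>"
  obtains \<delta> where "0 < \<delta>"
    "\<And>g z. \<lbrakk>continuous_on (lune_with_arc a c) g; g holomorphic_on open_lune a c;
        \<And>w. w \<in> open_lune a c \<Longrightarrow> norm (g w) \<le> M;
        \<And>w. \<lbrakk>norm w = 1; c < a \<bullet> w\<rbrakk> \<Longrightarrow> norm (g w) \<le> \<delta>;
        norm z \<le> 1; s \<le> a \<bullet> z\<rbrakk> \<Longrightarrow> norm (g z) \<le> \<eta>"
proof -
  define s' where "s' = (c + s) / 2"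
  have s': "c < s'" "s' < s"
    using \<open>c < s\<close> by (auto simp: s'_def)
  define K where "K = max M 1"
  have "K > 0" by (simp add: K_def)
  define \<mu> where "\<mu> = max 0 (ln (K / \<eta>) / (s - s'))"
  have "\<mu> \<ge> 0" by (simp add: \<mu>_def)
  have "ln (K / \<eta>) \<le> \<mu> * (s - s')"
    using s' by (simp add: \<mu>_def flip: pos_divide_le_eq)
  then have "K / \<eta> \<le> exp (\<mu> * (s - s'))"
    using \<open>K > 0\<close> \<open>\<eta> > 0\<close> by (metis divide_pos_pos exp_le_cancel_iff exp_ln)
  then have "K \<le> \<eta> * exp (\<mu> * (s - s'))"
    using \<open>\<eta> > 0\<close> by (simp add: pos_divide_le_eq mult.commute)
  then have "K * exp (- (\<mu> * (s - s'))) \<le> \<eta> * exp (\<mu> * (s - s')) * exp (- (\<mu> * (s - s')))"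
    by (rule mult_right_mono) simp
  then have K: "K * exp (- \<mu> * (s - s')) \<le> \<eta>"
    by (simp add: mult.assoc flip: exp_add)
  show ?thesis
  proof (rule that[of "exp (- \<mu> * (1 - s'))"])
    fix g z
    assume g: "continuous_on (lune_with_arc a c) g" "g holomorphic_on open_lune a c"
        "\<And>w. w \<in> open_lune a c \<Longrightarrow> norm (g w) \<le> M"
        "\<And>w. \<lbrakk>norm w = 1; c < a \<bullet> w\<rbrakk> \<Longrightarrow> norm (g w) \<le> exp (- \<mu> * (1 - s'))"
      and z: "norm z \<le> 1" "s \<le> a \<bullet> z"
    have "norm (g z) \<le> max M (exp (- \<mu> * (1 - s')) * exp (\<mu> * (1 - s'))) * exp (- \<mu> * (a \<bullet> z - s'))"
      using two_constants_lune[OF a s'(1) g \<open>\<mu> \<ge> 0\<close> z(1)] z s' by simp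
    also have "\<dots> = K * exp (- \<mu> * (a \<bullet> z - s'))"
      by (simp add: K_def flip: exp_add)
    also have "\<dots> \<le> K * exp (- \<mu> * (s - s'))"
      using z \<open>\<mu> \<ge> 0\<close> \<open>K > 0\<close> by (intro mult_left_mono) (auto intro!: mult_left_mono)
    finally show "norm (g z) \<le> \<eta>" using K by simp
  qed simp
qed

text \<open>Boundary uniqueness: on a slightly smaller lune \<open>g\<close> is bounded by compactness, and every
  \<open>\<delta>\<close> bounds \<open>g\<close> on the arc.\<close>

lemma vanishing_on_arc_imp_zero:
  fixes a :: complex
  assumes a: "norm a = 1" and "c < 1"
    and cont: "continuous_on (lune_with_arc a c) g" and hol: "g holomorphic_on open_lune a c"
    and zero: "\<And>w. \<lbrakk>norm w = 1; c < a \<bullet> w\<rbrakk> \<Longrightarrow> g w = 0"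
    and z: "z \<in> open_lune a c"
  shows "g z = 0"
proof -
  define c' where "c' = (c + a \<bullet> z) / 2"
  define s where "s = (c' + a \<bullet> z) / 2"
  have c: "c < c'" "c' < s" "s < a \<bullet> z"
    using z by (auto simp: c'_def s_def open_lune_def)
  have "compact (cball 0 1 \<inter> {w. a \<bullet> w \<ge> c'})"
    by (simp add: compact_Int_closed closed_halfspace_ge)
  moreover have "cball 0 1 \<inter> {w. a \<bullet> w \<ge> c'} \<subseteq> lune_with_arc a c"
    using c by (auto simp: lune_with_arc_def)
  ultimately have "bounded (g ` (cball 0 1 \<inter> {w. a \<bullet> w \<ge> c'}))"
    by (meson compact_continuous_image compact_imp_bounded continuous_on_subset cont)
  then obtain M where "\<forall>w \<in> cball 0 1 \<inter> {w. a \<bullet> w \<ge> c'}. norm (g w) \<le> M"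
    by (auto simp: bounded_iff)
  then have M: "\<And>w. \<lbrakk>norm w \<le> 1; a \<bullet> w \<ge> c'\<rbrakk> \<Longrightarrow> norm (g w) \<le> M"
    by simp
  have cont': "continuous_on (lune_with_arc a c') g"
    by (rule continuous_on_subset[OF cont]) (use c in \<open>auto simp: lune_with_arc_def\<close>)
  have hol': "g holomorphic_on open_lune a c'"
    by (rule holomorphic_on_subset[OF hol]) (use c in \<open>auto simp: open_lune_def\<close>)
  have "norm (g z) \<le> \<eta>" if "\<eta> > 0" for \<eta>
  proof -
    obtain \<delta> where "\<delta> > 0" and \<delta>: 
     "\<And>g z. \<lbrakk>continuous_on (lune_with_arc a c') g; g holomorphic_on open_lune a c';
        \<And>w. w \<in> open_lune a c' \<Longrightarrow> norm (g w) \<le> M;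
        \<And>w. \<lbrakk>norm w = 1; c' < a \<bullet> w\<rbrakk> \<Longrightarrow> norm (g w) \<le> \<delta>;
        norm z \<le> 1; s \<le> a \<bullet> z\<rbrakk> \<Longrightarrow> norm (g z) \<le> \<eta>"
      using small_on_arc_imp_small[OF a c(2) \<open>\<eta> > 0\<close>, of M] by blast
    show ?thesis
    proof (rule \<delta>[OF cont' hol'])
      show "norm (g w) \<le> M" if "w \<in> open_lune a c'" for w
        using that by (intro M) (auto simp: open_lune_def)
      show "norm (g w) \<le> \<delta>" if "norm w = 1" "c' < a \<bullet> w" for w
        using that c zero[of w] \<open>\<delta> > 0\<close> by simp
    qed (use z c in \<open>auto simp: open_lune_def\<close>)
  qed
  then have "norm (g z) \<le> 0"
    using field_le_epsilon[of "norm (g z)" 0] by simp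
  then show ?thesis by simp
qed

text \<open>The boundary function vanishes on the arc \<open>s \<le> a \<bullet> w\<close>, so \<open>g\<close> vanishes on the lune cut off
  there, hence everywhere by the identity theorem, hence by continuity also on the part of the arc
  with \<open>c < a \<bullet> w < s\<close>, where the prescribed values are different from zero.\<close>

lemma kink_not_boundary_value:
  fixes a :: complex and e :: real
  assumes a: "norm a = 1" and c: "0 \<le> c" "c < s" "s < 1" and "e \<noteq> 0"
    and cont: "continuous_on (lune_with_arc a c) g" and hol: "g holomorphic_on open_lune a c"
    and arc: "\<And>w. \<lbrakk>norm w = 1; c < a \<bullet> w\<rbrakk> \<Longrightarrow> g w = of_real (e * max 0 (s - a \<bullet> w))"
  shows False
proof -
  have aw: "a \<bullet> (of_real x * w) = x * (a \<bullet> w)" for x w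
    by (simp flip: scaleR_conv_of_real)
  have aa: "a \<bullet> (of_real x * a) = x" for x
    using a by (simp add: aw norm_eq_1)
  have zero: "g z = 0" if z: "z \<in> open_lune a c" for z
  proof (rule analytic_continuation_open[where f = g and g = "\<lambda>_. 0"])
    show "open_lune a s \<noteq> {}"
    proof -
      have "of_real ((s + 1) / 2) * a \<in> open_lune a s"
        unfolding open_lune_def mem_Collect_eq aa using a c by (simp add: norm_mult)
      then show ?thesis by auto
    qed
    show "open_lune a s \<subseteq> open_lune a c"
      using c by (auto simp: open_lune_def)
    show "g w = 0" if "w \<in> open_lune a s" for w
    proof (rule vanishing_on_arc_imp_zero[OF a \<open>s < 1\<close> _ _ _ that])
      show "continuous_on (lune_with_arc a s) g"
        by (rule continuous_on_subset[OF cont]) (use c in \<open>auto simp: lune_with_arc_def\<close>)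
      show "g holomorphic_on open_lune a s"
        by (rule holomorphic_on_subset[OF hol]) fact
    qed (use arc c in auto)
  qed (use hol z open_open_lune convex_connected[OF convex_open_lune] in auto)
  \<comment> \<open>\<open>p\<close> is the point of the circle with \<open>a \<bullet> p = t\<close>, where the boundary value is nonzero\<close>
  define t where "t = (c + s) / 2"
  have t: "c < t" "t < s" "0 \<le> t" "t < 1"
    using c by (auto simp: t_def)
  define p where "p = Complex t (sqrt (1 - t\<^sup>2)) * a"
  have "t\<^sup>2 \<le> 1"
    using t by (simp add: abs_square_le_1)
  then have "norm (Complex t (sqrt (1 - t\<^sup>2))) = 1"
    by (simp add: cmod_def)
  then have p: "norm p = 1"
    unfolding p_def norm_mult using a by simp
  have "a \<bullet> p = t * (norm a)\<^sup>2"
    unfolding cmod_power2 by (simp add: p_def inner_complex_def algebra_simps power2_eq_square)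
  then have ap: "a \<bullet> p = t"
    using a by simp
  \<comment> \<open>the segment from this point into the lune, ending at \<open>s * a\<close>\<close>
  define u where "u x = p + of_real x * (of_real s * a - p)" for x :: real
  have u: "u x \<in> open_lune a c" if "0 < x" "x \<le> 1" for x
  proof -
    have ux: "u x = of_real (1 - x) * p + of_real (x * s) * a"
      by (simp add: u_def algebra_simps)
    have "norm (u x) \<le> norm (of_real (1 - x) * p) + norm (of_real (x * s) * a)"
      unfolding ux by (rule norm_triangle_ineq)
    also have "\<dots> = (1 - x) + x * s"
      unfolding norm_mult norm_of_real p a using that c by simp
    also have "\<dots> < 1"
      using that c by (simp add: algebra_simps)
    finally have "norm (u x) < 1" .
    moreover have "a \<bullet> u x = (1 - x) * t + x * s"
      unfolding ux inner_add_right aa aw[of _ p] ap ..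
    moreover have "(1 - x) * t + x * s = t + x * (s - t)"
      by (simp add: algebra_simps)
    moreover have "0 \<le> x * (s - t)"
      using t that by simp
    ultimately show ?thesis
      using t by (simp add: open_lune_def)
  qed
  have "((\<lambda>x. g (u x)) \<longlongrightarrow> g (u 0)) (at_right 0)"
  proof (rule continuous_on_tendsto_compose[OF cont])
    show "(u \<longlongrightarrow> u 0) (at_right 0)"
      unfolding u_def by (intro tendsto_intros)
    show "u 0 \<in> lune_with_arc a c"
      using p ap t by (simp add: u_def lune_with_arc_def)
    have "\<forall>\<^sub>F x in at_right (0::real). x \<in> {0<..1}"
      using eventually_at_right_real[of 0 "1::real"] by (auto elim: eventually_mono)
    then show "\<forall>\<^sub>F x in at_right 0. u x \<in> lune_with_arc a c"
      by eventually_elim (use u in \<open>fastforce simp: open_lune_def lune_with_arc_def\<close>)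
  qed
  moreover have "((\<lambda>x. g (u x)) \<longlongrightarrow> 0) (at_right 0)"
  proof (rule tendsto_eventually)
    have "\<forall>\<^sub>F x in at_right (0::real). x \<in> {0<..1}"
      using eventually_at_right_real[of 0 "1::real"] by (auto elim: eventually_mono)
    then show "\<forall>\<^sub>F x in at_right 0. g (u x) = 0"
      by eventually_elim (use u zero in auto)
  qed
  ultimately have "g (u 0) = 0"
    using tendsto_unique trivial_limit_at_right_real by blast
  moreover have "g p = of_real (e * (s - t))"
    using arc[OF p] ap t by simp
  ultimately show False
    using t \<open>e \<noteq> 0\<close> by (simp add: u_def)
qed

section \<open>Limits of holomorphic functions of several variables\<close>

lemma norm_vector_scalar_mult:
  fixes v :: "complex ^ 'n"
  shows "norm (c *s v) = norm c * norm v"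
  by (simp add: norm_vec_def L2_set_def norm_mult power_mult_distrib real_sqrt_mult flip: sum_distrib_left)

lemma bounded_linear_vector_scalar_mult: "bounded_linear (\<lambda>t. t *s (v :: complex ^ 'n))"
  by (rule bounded_linear_intro[where K = "norm v"])
     (auto simp: vec_eq_iff algebra_simps norm_vector_scalar_mult)

lemma continuous_on_complex_line: "continuous_on A (\<lambda>t. p + t *s (v :: complex ^ 'n))"
  by (intro continuous_intros bounded_linear.continuous_on[OF bounded_linear_vector_scalar_mult])

text \<open>Complex-linearity of the Frechet derivative means that the restriction to a complex line is
  holomorphic in one variable; this is how one-variable theory enters.\<close>

lemma has_field_derivative_complex_line:
  fixes F :: "complex ^ 'n \<Rightarrow> complex"
  assumes F': "(F has_derivative F') (at (p + t *s v))" and lin: "\<And>c v. F' (c *s v) = c * F' v"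
  shows "((\<lambda>t. F (p + t *s v)) has_field_derivative F' v) (at t)"
proof -
  have "((\<lambda>t. p + t *s v) has_derivative (\<lambda>t. t *s v)) (at t)"
    using has_derivative_add[OF has_derivative_const
        bounded_linear_imp_has_derivative[OF bounded_linear_vector_scalar_mult]] by simp
  then have "((\<lambda>t. F (p + t *s v)) has_derivative (\<lambda>t. F' (t *s v))) (at t)"
    using has_derivative_compose F' by blast
  moreover have "(\<lambda>t. F' (t *s v)) = (*) (F' v)"
    by (simp add: lin mult.commute fun_eq_iff)
  ultimately show ?thesis
    by (simp add: has_field_derivative_def)
qed

lemma holomorphic_sev_on_complex_line:
  fixes F :: "complex ^ 'n \<Rightarrow> complex"
  assumes "holomorphic_sev_on F S"
  shows "(\<lambda>t. F (p + t *s v)) holomorphic_on {t. p + t *s v \<in> S}"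
  unfolding holomorphic_on_def
proof
  fix t assume "t \<in> {t. p + t *s v \<in> S}"
  then obtain F' where "(F has_derivative F') (at (p + t *s v))" "\<And>c v. F' (c *s v) = c * F' v"
    using assms by (auto simp: holomorphic_sev_on_def)
  then show "(\<lambda>t. F (p + t *s v)) field_differentiable at t within {t. p + t *s v \<in> S}"
    using has_field_derivative_complex_line field_differentiable_at_within field_differentiable_def by blast
qed

lemma holomorphic_sev_on_diff:
  fixes F :: "complex ^ 'n \<Rightarrow> complex"
  assumes "holomorphic_sev_on F S" "holomorphic_sev_on G S"
  shows "holomorphic_sev_on (\<lambda>z. F z - G z) S"
  unfolding holomorphic_sev_on_def
proof
  fix z assume "z \<in> S"
  then obtain F' G' where "(F has_derivative F') (at z)" "\<forall>c v. F' (c *s v) = c * F' v"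
      "(G has_derivative G') (at z)" "\<forall>c v. G' (c *s v) = c * G' v"
    using assms unfolding holomorphic_sev_on_def by meson
  then show "\<exists>H. ((\<lambda>z. F z - G z) has_derivative H) (at z) \<and> (\<forall>c v. H (c *s v) = c * H v)"
    by (intro exI[of _ "\<lambda>v. F' v - G' v"]) (auto intro: has_derivative_diff simp: algebra_simps)
qed

lemma holomorphic_sev_on_subset:
  "holomorphic_sev_on F S \<Longrightarrow> T \<subseteq> S \<Longrightarrow> holomorphic_sev_on F T"
  by (auto simp: holomorphic_sev_on_def)

text \<open>The one-variable Cauchy inequality on the complex line through \<open>z\<close> in direction \<open>h\<close>.\<close>

lemma Cauchy_estimate_has_derivative:
  fixes F :: "complex ^ 'n \<Rightarrow> complex"
  assumes hol: "holomorphic_sev_on F (cball z \<rho>)" and "0 < \<rho>"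
    and B: "\<And>w. w \<in> cball z \<rho> \<Longrightarrow> norm (F w) \<le> B"
    and F': "(F has_derivative F') (at z)" and lin: "\<And>c v. F' (c *s v) = c * F' v"
  shows "norm (F' h) \<le> B / \<rho> * norm h"
proof (cases "h = 0")
  case True
  then show ?thesis
    using lin[of 0 0] by simp
next
  case False
  define \<phi> where "\<phi> t = F (z + t *s h)" for t
  define r where "r = \<rho> / norm h"
  have "r > 0"
    using False \<open>\<rho> > 0\<close> by (simp add: r_def)
  have in_ball: "z + t *s h \<in> cball z \<rho>" if "norm t \<le> r" for t
    using that False by (simp add: dist_norm norm_vector_scalar_mult r_def field_simps)
  have hol': "\<phi> holomorphic_on cball 0 r"
    unfolding \<phi>_def
    by (rule holomorphic_on_subset[OF holomorphic_sev_on_complex_line[OF hol]]) (use in_ball in auto)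
  have "norm ((deriv ^^ 1) \<phi> 0) \<le> fact 1 * B / r ^ 1"
  proof (rule Cauchy_inequality)
    show "\<phi> holomorphic_on ball 0 r"
      using hol' by (rule holomorphic_on_subset) auto
    show "continuous_on (cball 0 r) \<phi>"
      using hol' by (rule holomorphic_on_imp_continuous_on)
    show "norm (\<phi> t) \<le> B" if "norm (0 - t) = r" for t
      using B in_ball[of t] that by (simp add: \<phi>_def)
  qed fact
  moreover have "deriv \<phi> 0 = F' h"
    unfolding \<phi>_def using F' lin by (intro DERIV_imp_deriv has_field_derivative_complex_line) simp_all
  ultimately show ?thesis
    by (simp add: r_def)
qed

text \<open>By Cauchy estimates on balls of a fixed radius, uniform convergence of the functions entails uniform
  convergence of their derivatives as linear maps, so the limit is differentiable and its derivative
  is complex-linear as a limit of such maps.\<close>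

lemma holomorphic_sev_on_uniform_limit:
  fixes f :: "nat \<Rightarrow> complex ^ 'n \<Rightarrow> complex"
  assumes hol: "\<And>k. holomorphic_sev_on (f k) S"
    and lim: "\<And>z. z \<in> S \<Longrightarrow> \<exists>\<rho>>0. ball z \<rho> \<subseteq> S \<and> uniform_limit (ball z \<rho>) f g sequentially"
  shows "holomorphic_sev_on g S"
  unfolding holomorphic_sev_on_def
proof
  fix z assume "z \<in> S"
  obtain \<rho> where "\<rho> > 0" and \<rho>: "ball z \<rho> \<subseteq> S" "uniform_limit (ball z \<rho>) f g sequentially"
    using lim[OF \<open>z \<in> S\<close>] by blast
  define T where "T = ball z (\<rho> / 2)"
  have T: "T \<subseteq> S" "z \<in> T" "convex T" "open T"
    using \<rho> \<open>\<rho> > 0\<close> by (auto simp: T_def)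
  have near: "cball x (\<rho> / 4) \<subseteq> ball z \<rho>" if "x \<in> T" for x
  proof
    fix w assume "w \<in> cball x (\<rho> / 4)"
    then show "w \<in> ball z \<rho>"
      using that \<open>\<rho> > 0\<close> dist_triangle[of z w x] by (simp add: T_def)
  qed
  have "\<forall>k. \<forall>x\<in>T. \<exists>D. (f k has_derivative D) (at x) \<and> (\<forall>c v. D (c *s v) = c * D v)"
    using hol T unfolding holomorphic_sev_on_def by blast
  then obtain D where D: "\<And>k x. x \<in> T \<Longrightarrow> (f k has_derivative D k x) (at x)"
    and D_lin: "\<And>k x c v. x \<in> T \<Longrightarrow> D k x (c *s v) = c * D k x v"
    by metis
  have Cauchy_D: "\<exists>N. \<forall>m\<ge>N. \<forall>n\<ge>N. \<forall>x\<in>T. \<forall>h. norm (D m x h - D n x h) \<le> e * norm h" if "e > 0" for e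
  proof -
    have "uniformly_Cauchy_on (ball z \<rho>) f"
      using \<rho> by (meson uniformly_convergent_Cauchy uniformly_convergentI)
    moreover have "e * (\<rho> / 4) > 0"
      using that \<open>\<rho> > 0\<close> by simp
    ultimately obtain N where N: "\<And>m n x. \<lbrakk>m \<ge> N; n \<ge> N; x \<in> ball z \<rho>\<rbrakk> \<Longrightarrow> dist (f m x) (f n x) < e * (\<rho> / 4)"
      unfolding uniformly_Cauchy_on_def by metis
    show ?thesis
    proof (intro exI[of _ N] allI ballI impI)
      fix m n x h assume mn: "N \<le> m" "N \<le> n" and x: "x \<in> T"
      have "norm (D m x h - D n x h) \<le> e * (\<rho> / 4) / (\<rho> / 4) * norm h"
      proof (rule Cauchy_estimate_has_derivative[where F = "\<lambda>w. f m w - f n w" and z = x])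
        show "holomorphic_sev_on (\<lambda>w. f m w - f n w) (cball x (\<rho> / 4))"
          by (rule holomorphic_sev_on_diff; rule holomorphic_sev_on_subset[OF hol])
             (use near[OF x] \<rho> in auto)
        show "norm (f m w - f n w) \<le> e * (\<rho> / 4)" if "w \<in> cball x (\<rho> / 4)" for w
          using N[OF mn, of w] near[OF x] that by (auto simp: dist_norm)
        show "((\<lambda>w. f m w - f n w) has_derivative (\<lambda>h. D m x h - D n x h)) (at x)"
          by (intro has_derivative_diff D x)
        show "D m x (c *s v) - D n x (c *s v) = c * (D m x v - D n x v)" for c v
          by (simp add: D_lin x algebra_simps)
      qed (use \<open>\<rho> > 0\<close> in simp)
      then show "norm (D m x h - D n x h) \<le> e * norm h"
        using \<open>\<rho> > 0\<close> by simp
    qed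
  qed
  define g' where "g' x h = lim (\<lambda>k. D k x h)" for x h
  have g': "(\<lambda>k. D k x h) \<longlonglongrightarrow> g' x h" if x: "x \<in> T" for x h
  proof -
    have "Cauchy (\<lambda>k. D k x h)"
    proof (rule metric_CauchyI)
      fix e :: real assume "e > 0"
      then have "e / (norm h + 1) > 0"
        by (simp add: add_nonneg_pos)
      then obtain N where N: "\<And>m n. \<lbrakk>m \<ge> N; n \<ge> N\<rbrakk> \<Longrightarrow> norm (D m x h - D n x h) \<le> e / (norm h + 1) * norm h"
        using Cauchy_D x by metis
      have "e / (norm h + 1) * norm h < e / (norm h + 1) * (norm h + 1)"
        using \<open>e / (norm h + 1) > 0\<close> by (intro mult_strict_left_mono) auto
      also have "\<dots> = e"
        by (simp add: add_nonneg_eq_0_iff)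
      finally have "dist (D m x h) (D n x h) < e" if "m \<ge> N" "n \<ge> N" for m n
        using N[OF that] unfolding dist_norm by (rule le_less_trans[rotated])
      then show "\<exists>N. \<forall>m\<ge>N. \<forall>n\<ge>N. dist (D m x h) (D n x h) < e"
        by blast
    qed
    then show ?thesis
      unfolding g'_def convergent_LIMSEQ_iff[symmetric] by (rule Cauchy_convergent)
  qed
  have "\<exists>l. \<forall>x\<in>T. (\<lambda>k. f k x) \<longlonglongrightarrow> l x \<and> (l has_derivative g' x) (at x within T)"
  proof (rule has_derivative_sequence[OF \<open>convex T\<close>])
    show "(f k has_derivative D k x) (at x within T)" if "x \<in> T" for k x
      using D[OF that] by (rule has_derivative_at_withinI)
    show "\<forall>\<^sub>F k in sequentially. \<forall>x\<in>T. \<forall>h. norm (D k x h - g' x h) \<le> e * norm h" if "e > 0" for e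
    proof -
      obtain N where N: "\<And>m n x h. \<lbrakk>m \<ge> N; n \<ge> N; x \<in> T\<rbrakk> \<Longrightarrow> norm (D m x h - D n x h) \<le> e * norm h"
        using Cauchy_D[OF \<open>e > 0\<close>] by metis
      have "norm (D m x h - g' x h) \<le> e * norm h" if "m \<ge> N" "x \<in> T" for m x h
      proof (rule tendsto_upperbound)
        show "(\<lambda>n. norm (D m x h - D n x h)) \<longlonglongrightarrow> norm (D m x h - g' x h)"
          by (intro tendsto_intros g' that)
        show "\<forall>\<^sub>F n in sequentially. norm (D m x h - D n x h) \<le> e * norm h"
          using N[of m _ x h] that unfolding eventually_sequentially by blast
      qed simp
      then show ?thesis
        by (auto simp: eventually_sequentially)
    qed
    show "z \<in> T" by fact
    show "(\<lambda>k. f k z) \<longlonglongrightarrow> g z"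
      using tendsto_uniform_limitI[OF \<rho>(2)] \<open>\<rho> > 0\<close> by simp
  qed
  then obtain l where l: "\<And>x. x \<in> T \<Longrightarrow> (\<lambda>k. f k x) \<longlonglongrightarrow> l x"
      "\<And>x. x \<in> T \<Longrightarrow> (l has_derivative g' x) (at x within T)"
    by blast
  have "l x = g x" if "x \<in> T" for x
  proof (rule LIMSEQ_unique[OF l(1)[OF that]])
    show "(\<lambda>k. f k x) \<longlonglongrightarrow> g x"
      using tendsto_uniform_limitI[OF \<rho>(2)] that \<open>\<rho> > 0\<close> by (simp add: T_def)
  qed
  moreover have "(l has_derivative g' z) (at z)"
    using l(2) T at_within_open by metis
  ultimately have "(g has_derivative g' z) (at z)"
    using has_derivative_transform_within_open[OF _ \<open>open T\<close> \<open>z \<in> T\<close>] by blast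
  moreover have "g' z (c *s v) = c * g' z v" for c v
  proof (rule LIMSEQ_unique[OF g'[OF \<open>z \<in> T\<close>]])
    show "(\<lambda>k. D k z (c *s v)) \<longlonglongrightarrow> c * g' z v"
      unfolding D_lin[OF \<open>z \<in> T\<close>] by (intro tendsto_intros g' T)
  qed
  ultimately show "\<exists>g'. (g has_derivative g') (at z) \<and> (\<forall>c v. g' (c *s v) = c * g' v)"
    by blast
qed

section \<open>The boundary of the polydisc and its coordinate slices\<close>

lemma open_polydisc: "open (polydisc :: (complex ^ 'n) set)"
proof -
  have eq: "polydisc = (\<Inter>i. {z :: complex ^ 'n. norm (z $ i) < 1})"
    by (auto simp: polydisc_def)
  show ?thesis
    unfolding eq by (intro open_INT ballI open_Collect_less continuous_intros) auto
qed

lemma closure_polydisc: "closure polydisc = {z :: complex ^ 'n. \<forall>i. norm (z $ i) \<le> 1}"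
proof
  have "closed {z :: complex ^ 'n. \<forall>i. norm (z $ i) \<le> 1}"
    by (intro closed_Collect_all closed_Collect_le continuous_intros)
  then show "closure polydisc \<subseteq> {z :: complex ^ 'n. \<forall>i. norm (z $ i) \<le> 1}"
    by (rule closure_minimal[rotated]) (auto simp: polydisc_def less_imp_le)
next
  show "{z :: complex ^ 'n. \<forall>i. norm (z $ i) \<le> 1} \<subseteq> closure polydisc"
  proof
    fix z :: "complex ^ 'n" assume z: "z \<in> {z. \<forall>i. norm (z $ i) \<le> 1}"
    define u where "u k = (1 - inverse (real (Suc k))) *\<^sub>R z" for k
    have "u k \<in> polydisc" for k
    proof -
      have k: "0 \<le> 1 - inverse (real (Suc k))" "1 - inverse (real (Suc k)) < 1"
        by (auto simp: field_simps)
      have "norm (u k $ i) < 1" for i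
      proof -
        have "norm (u k $ i) = (1 - inverse (real (Suc k))) * norm (z $ i)"
          using k by (simp add: u_def)
        also have "\<dots> \<le> (1 - inverse (real (Suc k))) * 1"
          using z k by (intro mult_left_mono) auto
        also have "\<dots> < 1"
          using k by simp
        finally show ?thesis .
      qed
      then show ?thesis by (simp add: polydisc_def)
    qed
    moreover have "u \<longlonglongrightarrow> (1 - 0) *\<^sub>R z"
      unfolding u_def by (intro tendsto_intros LIMSEQ_inverse_real_of_nat)
    ultimately show "z \<in> closure polydisc"
      by (auto simp: closure_sequential)
  qed
qed

lemma frontier_polydisc:
  "frontier polydisc = {z :: complex ^ 'n. (\<forall>i. norm (z $ i) \<le> 1) \<and> (\<exists>i. norm (z $ i) = 1)}"
proof (rule set_eqI)
  fix z :: "complex ^ 'n"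
  have "z \<in> frontier polydisc \<longleftrightarrow> (\<forall>i. norm (z $ i) \<le> 1) \<and> (\<exists>i. \<not> norm (z $ i) < 1)"
    unfolding frontier_def closure_polydisc interior_open[OF open_polydisc] by (simp add: polydisc_def)
  moreover have "\<not> norm (z $ i) < 1 \<longleftrightarrow> norm (z $ i) = 1" if "\<forall>i. norm (z $ i) \<le> 1" for i
    using that[rule_format, of i] by linarith
  ultimately show "z \<in> frontier polydisc \<longleftrightarrow> z \<in> {z. (\<forall>i. norm (z $ i) \<le> 1) \<and> (\<exists>i. norm (z $ i) = 1)}"
    unfolding mem_Collect_eq by metis
qed

lemma replace_coord_nth [simp]: "replace_coord z i w $ j = (if j = i then w else z $ j)"
  by (simp add: replace_coord_def)

lemma replace_coord_same [simp]: "replace_coord z i (z $ i) = z"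
  by (simp add: vec_eq_iff)

lemma replace_coord_eq_line: "replace_coord z i w = replace_coord z i 0 + w *s axis i 1"
  by (auto simp: vec_eq_iff axis_def)

lemma continuous_on_replace_coord: "continuous_on A (replace_coord z i)"
proof -
  have "replace_coord z i = (\<lambda>w. replace_coord z i 0 + w *s axis i 1)"
    using replace_coord_eq_line by blast
  then show ?thesis
    using continuous_on_complex_line[of A "replace_coord z i 0" "axis i 1"] by metis
qed

lemma tendsto_replace_coord: "(replace_coord z i \<longlongrightarrow> replace_coord z i w) (at w within A)"
  using continuous_on_replace_coord[of UNIV z i] tendsto_within_subset
  unfolding continuous_on_def by blast

section \<open>Extensions to boxes that touch the boundary\<close>

text \<open>For \<open>\<bar>b\<^sub>i\<bar> = 1\<close>, the condition on the coordinate \<open>i\<close> is a half-plane which cuts the lune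
  \<open>open_lune (b $ i) (1 - r)\<close> out of the disc, so that slices in direction \<open>i\<close> are full lunes.\<close>

definition touching_box :: "'n \<Rightarrow> complex ^ 'n \<Rightarrow> real \<Rightarrow> (complex ^ 'n) set" where
  "touching_box i b r = {z. 1 - r < b $ i \<bullet> z $ i \<and> (\<forall>j. j \<noteq> i \<longrightarrow> dist (b $ j) (z $ j) < r)}"

text \<open>Continuity at the boundary is demanded only on slices in direction \<open>i\<close> and only over the open
  arc. This is weak enough to pass to limits and, after shrinking the box, it still
  yields a separately continuous extension.\<close>

definition box_extension ::
  "'n \<Rightarrow> complex ^ 'n \<Rightarrow> real \<Rightarrow> real \<Rightarrow> (complex ^ 'n \<Rightarrow> complex) \<Rightarrow> (complex ^ 'n \<Rightarrow> complex) \<Rightarrow> bool" where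
  "box_extension i b r M f F \<longleftrightarrow>
    holomorphic_sev_on F (touching_box i b r \<inter> polydisc) \<and>
    (\<forall>z\<in>touching_box i b r \<inter> polydisc. norm (F z) \<le> M) \<and>
    (\<forall>z\<in>touching_box i b r. continuous_on (lune_with_arc (b $ i) (1 - r)) (\<lambda>w. F (replace_coord z i w))) \<and>
    (\<forall>z\<in>frontier polydisc. F z = f z)"

text \<open>The condition on the coordinates \<open>j \<noteq> i\<close> keeps their discs inside the unit disc, so the box meets
  the boundary of the polydisc exactly in the face where the \<open>i\<close>-th coordinate has modulus one.\<close>

locale admissible_box =
  fixes i :: "'n :: finite" and b :: "complex ^ 'n" and r :: real
  assumes unit: "norm (b $ i) = 1" and r: "0 < r" "r \<le> 1"
    and inside: "\<And>j. j \<noteq> i \<Longrightarrow> norm (b $ j) + r \<le> 1"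
begin

abbreviation B where "B \<equiv> touching_box i b r"

lemma open_touching_box: "open (touching_box i b r')"
proof -
  have "open {z :: complex ^ 'n. j \<noteq> i \<longrightarrow> dist (b $ j) (z $ j) < r'}" for j
    by (cases "j = i") (auto intro!: open_Collect_less continuous_intros)
  then have "open ({z. 1 - r' < b $ i \<bullet> z $ i} \<inter> (\<Inter>j. {z :: complex ^ 'n. j \<noteq> i \<longrightarrow> dist (b $ j) (z $ j) < r'}))"
    by (intro open_Int open_INT open_Collect_less continuous_intros) auto
  also have "\<dots> = touching_box i b r'"
    by (auto simp: touching_box_def)
  finally show ?thesis .
qed

lemma open_box_polydisc: "open (B \<inter> polydisc)"
  by (intro open_Int open_touching_box open_polydisc)

lemma norm_other_coord:
  fixes z :: "complex ^ 'n"
  assumes "z \<in> B" "j \<noteq> i"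
  shows "norm (z $ j) < 1"
proof -
  have "norm (z $ j) \<le> norm (b $ j) + dist (b $ j) (z $ j)"
    by (metis add.commute dist_commute dist_norm norm_triangle_sub)
  then show ?thesis
    using assms inside[of j] by (auto simp: touching_box_def)
qed

lemma box_polydisc_iff:
  assumes "z \<in> B"
  shows "z \<in> polydisc \<longleftrightarrow> norm (z $ i) < 1"
proof
  assume "norm (z $ i) < 1"
  then have "norm (z $ j) < 1" for j
    using norm_other_coord[OF assms, of j] by (cases "j = i") auto
  then show "z \<in> polydisc"
    by (simp add: polydisc_def)
qed (simp add: polydisc_def)

lemma box_frontier_iff:
  assumes "z \<in> B"
  shows "z \<in> frontier polydisc \<longleftrightarrow> norm (z $ i) = 1"
proof
  assume "z \<in> frontier polydisc"
  then obtain j where "norm (z $ j) = 1"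
    by (auto simp: frontier_polydisc)
  then show "norm (z $ i) = 1"
    using norm_other_coord[OF assms, of j] by (cases "j = i") auto
next
  assume *: "norm (z $ i) = 1"
  then have "norm (z $ j) \<le> 1" for j
    using norm_other_coord[OF assms, of j] by (cases "j = i") auto
  then show "z \<in> frontier polydisc"
    using * by (auto simp: frontier_polydisc)
qed

lemma center: "b \<in> B" "b \<in> frontier polydisc"
proof -
  show "b \<in> B"
    using r unit by (simp add: touching_box_def norm_eq_1)
  then show "b \<in> frontier polydisc"
    using unit by (simp add: box_frontier_iff)
qed

lemma slice_box: "z \<in> B \<Longrightarrow> 1 - r < b $ i \<bullet> w \<Longrightarrow> replace_coord z i w \<in> B"
  by (simp add: touching_box_def)

lemma slice_polydisc: "z \<in> B \<Longrightarrow> w \<in> open_lune (b $ i) (1 - r) \<Longrightarrow> replace_coord z i w \<in> B \<inter> polydisc"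
  using slice_box[of z w] box_polydisc_iff[of "replace_coord z i w"] by (simp add: open_lune_def)

lemma slice_frontier:
  "z \<in> B \<Longrightarrow> norm w = 1 \<Longrightarrow> 1 - r < b $ i \<bullet> w \<Longrightarrow> replace_coord z i w \<in> frontier polydisc"
  using slice_box[of z w] box_frontier_iff[of "replace_coord z i w"] by simp

lemma holomorphic_slice:
  assumes "holomorphic_sev_on F (B \<inter> polydisc)" "z \<in> B"
  shows "(\<lambda>w. F (replace_coord z i w)) holomorphic_on open_lune (b $ i) (1 - r)"
proof -
  define p where "p = replace_coord z i 0"
  have line: "replace_coord z i w = p + w *s axis i 1" for w
    unfolding p_def by (rule replace_coord_eq_line)
  have "(\<lambda>w. F (p + w *s axis i 1)) holomorphic_on open_lune (b $ i) (1 - r)"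
    by (rule holomorphic_on_subset[OF holomorphic_sev_on_complex_line[OF assms(1)]])
       (use slice_polydisc[OF assms(2)] in \<open>auto simp: line\<close>)
  then show ?thesis
    by (simp add: line)
qed

text \<open>The difference of two extensions is bounded by \<open>2 * M\<close>, and on each slice in direction \<open>i\<close> its
  values on the arc are the difference of the boundary functions.\<close>

lemma box_extensions_close:
  assumes "1 - r < s" "0 < \<eta>"
  obtains \<delta> where "0 < \<delta>"
    "\<And>f g F G z. \<lbrakk>box_extension i b r M f F; box_extension i b r M g G;
        \<And>z. z \<in> frontier polydisc \<Longrightarrow> norm (f z - g z) \<le> \<delta>;
        z \<in> B; norm (z $ i) \<le> 1; s \<le> b $ i \<bullet> z $ i\<rbrakk> \<Longrightarrow> norm (F z - G z) \<le> \<eta>"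
proof -
  obtain \<delta> where "0 < \<delta>" and \<delta>:
    "\<And>h w. \<lbrakk>continuous_on (lune_with_arc (b $ i) (1 - r)) h; h holomorphic_on open_lune (b $ i) (1 - r);
        \<And>w. w \<in> open_lune (b $ i) (1 - r) \<Longrightarrow> norm (h w) \<le> 2 * M;
        \<And>w. \<lbrakk>norm w = 1; 1 - r < b $ i \<bullet> w\<rbrakk> \<Longrightarrow> norm (h w) \<le> \<delta>;
        norm w \<le> 1; s \<le> b $ i \<bullet> w\<rbrakk> \<Longrightarrow> norm (h w) \<le> \<eta>"
    using small_on_arc_imp_small[OF unit assms, of "2 * M"] by blast
  show ?thesis
  proof (rule that[OF \<open>0 < \<delta>\<close>])
    fix f g F G z
    assume F: "box_extension i b r M f F" and G: "box_extension i b r M g G"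
      and close: "\<And>z. z \<in> frontier polydisc \<Longrightarrow> norm (f z - g z) \<le> \<delta>"
      and z: "z \<in> B" "norm (z $ i) \<le> 1" "s \<le> b $ i \<bullet> z $ i"
    define h where "h w = F (replace_coord z i w) - G (replace_coord z i w)" for w
    have "norm (h (z $ i)) \<le> \<eta>"
    proof (rule \<delta>[of h])
      show "continuous_on (lune_with_arc (b $ i) (1 - r)) h"
        unfolding h_def using F G z by (intro continuous_on_diff) (auto simp: box_extension_def)
      show "h holomorphic_on open_lune (b $ i) (1 - r)"
        unfolding h_def using F G z
        by (intro holomorphic_on_diff holomorphic_slice) (auto simp: box_extension_def)
      show "norm (h w) \<le> 2 * M" if "w \<in> open_lune (b $ i) (1 - r)" for w
      proof -
        have "norm (F (replace_coord z i w)) \<le> M" "norm (G (replace_coord z i w)) \<le> M"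
          using F G slice_polydisc[OF z(1) that] by (auto simp: box_extension_def)
        then show ?thesis
          unfolding h_def using norm_triangle_ineq4[of "F (replace_coord z i w)" "G (replace_coord z i w)"]
          by simp
      qed
      show "norm (h w) \<le> \<delta>" if "norm w = 1" "1 - r < b $ i \<bullet> w" for w
        using F G close slice_frontier[OF z(1) that] by (simp add: h_def box_extension_def)
    qed (use z in auto)
    then show "norm (F z - G z) \<le> \<eta>"
      by (simp add: h_def)
  qed
qed

text \<open>The sets \<open>K s\<close> in the proof exhaust the box together with its boundary face as \<open>s\<close> decreases to
  \<open>1 - r\<close>, and on each of them the extensions form a uniform Cauchy sequence. Including the face in
  \<open>K s\<close> gives continuity of the slices of the limit.\<close>

lemma box_extension_limit:
  assumes F: "\<And>k. box_extension i b r M (f k) (F k)"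
    and lim: "uniform_limit (frontier polydisc) f g sequentially"
  obtains G where "box_extension i b r M g G"
    "\<And>z. z \<in> (B \<inter> polydisc) \<union> frontier polydisc \<Longrightarrow> (\<lambda>k. F k z) \<longlonglongrightarrow> G z"
proof -
  define K where "K s = {z \<in> B. norm (z $ i) \<le> 1 \<and> s \<le> b $ i \<bullet> z $ i}" for s
  define G where "G z = (if z \<in> frontier polydisc then g z else lim (\<lambda>k. F k z))" for z
  have frontier_lim: "(\<lambda>k. F k z) \<longlonglongrightarrow> G z" if "z \<in> frontier polydisc" for z
  proof -
    have "F k z = f k z" for k
      using F[of k] that by (simp add: box_extension_def)
    then show ?thesis
      using tendsto_uniform_limitI[OF lim that] that by (simp add: G_def)
  qed
  have unif: "uniform_limit (K s) F G sequentially" if s: "1 - r < s" for s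
  proof -
    have "uniformly_Cauchy_on (K s) F"
    proof (rule uniformly_Cauchy_onI)
      fix e :: real assume "e > 0"
      then have "e / 2 > 0" by simp
      from box_extensions_close[OF s this, of M] obtain \<delta> where "0 < \<delta>" and \<delta>:
        "\<And>f g F G z. \<lbrakk>box_extension i b r M f F; box_extension i b r M g G;
            \<And>z. z \<in> frontier polydisc \<Longrightarrow> norm (f z - g z) \<le> \<delta>;
            z \<in> B; norm (z $ i) \<le> 1; s \<le> b $ i \<bullet> z $ i\<rbrakk> \<Longrightarrow> norm (F z - G z) \<le> e / 2"
        by blast
      have "uniformly_Cauchy_on (frontier polydisc) f"
        using lim by (meson uniformly_convergent_Cauchy uniformly_convergentI)
      then obtain N where N: "\<And>m n z. \<lbrakk>m \<ge> N; n \<ge> N; z \<in> frontier polydisc\<rbrakk> \<Longrightarrow> dist (f m z) (f n z) < \<delta>"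
        using \<open>0 < \<delta>\<close> unfolding uniformly_Cauchy_on_def by metis
      have "dist (F m z) (F n z) < e" if "z \<in> K s" "m \<ge> N" "n \<ge> N" for m n z
      proof -
        have "norm (F m z - F n z) \<le> e / 2"
          by (rule \<delta>[OF F F]) (use N[OF that(2,3)] that in \<open>auto simp: K_def dist_norm less_imp_le\<close>)
        then show ?thesis
          using \<open>e > 0\<close> by (simp add: dist_norm)
      qed
      then show "\<exists>N. \<forall>z\<in>K s. \<forall>m\<ge>N. \<forall>n\<ge>N. dist (F m z) (F n z) < e"
        by blast
    qed
    then obtain l where l: "uniform_limit (K s) F l sequentially"
      using Cauchy_uniformly_convergent uniformly_convergent_on_def by blast
    have "l z = G z" if "z \<in> K s" for z
    proof (cases "z \<in> frontier polydisc")
      case True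
      show ?thesis
        by (rule LIMSEQ_unique[OF tendsto_uniform_limitI[OF l that] frontier_lim[OF True]])
    next
      case False
      then show ?thesis
        using limI[OF tendsto_uniform_limitI[OF l that]] by (simp add: G_def)
    qed
    then show ?thesis
      using l uniform_limit_cong'[of "K s" F F l G] by blast
  qed
  have lim_G: "(\<lambda>k. F k z) \<longlonglongrightarrow> G z" if z: "z \<in> B \<inter> polydisc" for z
  proof (rule tendsto_uniform_limitI[OF unif])
    show "1 - r < b $ i \<bullet> z $ i"
      using z by (auto simp: touching_box_def)
    show "z \<in> K (b $ i \<bullet> z $ i)"
      using z box_polydisc_iff[of z] by (auto simp: K_def)
  qed
  have "box_extension i b r M g G"
    unfolding box_extension_def
  proof (intro conjI ballI)
    show "holomorphic_sev_on G (B \<inter> polydisc)"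
    proof (rule holomorphic_sev_on_uniform_limit[where f = F])
      show "holomorphic_sev_on (F k) (B \<inter> polydisc)" for k
        using F by (auto simp: box_extension_def)
      fix z assume z: "z \<in> B \<inter> polydisc"
      then have "1 - r < b $ i \<bullet> z $ i"
        by (auto simp: touching_box_def)
      then obtain s where s: "1 - r < s" "s < b $ i \<bullet> z $ i"
        using dense by blast
      have "open (B \<inter> polydisc \<inter> {z. s < b $ i \<bullet> z $ i})"
        by (intro open_Int open_box_polydisc open_Collect_less continuous_intros)
      then obtain \<rho> where "\<rho> > 0" and \<rho>: "ball z \<rho> \<subseteq> B \<inter> polydisc \<inter> {z. s < b $ i \<bullet> z $ i}"
        using z s by (metis (mono_tags, lifting) Int_iff mem_Collect_eq open_contains_ball)
      have "ball z \<rho> \<subseteq> K s"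
      proof
        fix x assume "x \<in> ball z \<rho>"
        then have "x \<in> B" "x \<in> polydisc" "s < b $ i \<bullet> x $ i"
          using \<rho> by auto
        then show "x \<in> K s"
          using box_polydisc_iff[of x] by (simp add: K_def)
      qed
      then have "uniform_limit (ball z \<rho>) F G sequentially"
        using unif[OF s(1)] uniform_limit_on_subset by blast
      then show "\<exists>\<rho>>0. ball z \<rho> \<subseteq> B \<inter> polydisc \<and> uniform_limit (ball z \<rho>) F G sequentially"
        using \<rho> \<open>\<rho> > 0\<close> by auto
    qed
  next
    fix z assume z: "z \<in> B \<inter> polydisc"
    show "norm (G z) \<le> M"
    proof (rule tendsto_upperbound[OF tendsto_norm[OF lim_G[OF z]]])
      show "\<forall>\<^sub>F k in sequentially. norm (F k z) \<le> M"
        using F z by (intro always_eventually) (auto simp: box_extension_def)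
    qed simp
  next
    fix z assume z: "z \<in> B"
    let ?L = "lune_with_arc (b $ i) (1 - r)"
    show "continuous_on ?L (\<lambda>w. G (replace_coord z i w))"
      unfolding continuous_on_eq_continuous_within
    proof
      fix w assume w: "w \<in> ?L"
      then obtain s where s: "1 - r < s" "s < b $ i \<bullet> w"
        using dense by (auto simp: lune_with_arc_def)
      define A where "A = ?L \<inter> {w. s \<le> b $ i \<bullet> w}"
      have "uniform_limit A (\<lambda>k w. F k (replace_coord z i w)) (\<lambda>w. G (replace_coord z i w)) sequentially"
      proof (rule uniform_limit_compose'[OF unif[OF s(1)]])
        show "replace_coord z i \<in> A \<rightarrow> K s"
          using slice_box[OF z] by (auto simp: A_def K_def lune_with_arc_def)
      qed
      moreover have "\<forall>\<^sub>F k in sequentially. continuous_on A (\<lambda>w. F k (replace_coord z i w))"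
      proof (rule always_eventually, rule allI)
        fix k
        have "continuous_on ?L (\<lambda>w. F k (replace_coord z i w))"
          using F[of k] z by (simp add: box_extension_def)
        then show "continuous_on A (\<lambda>w. F k (replace_coord z i w))"
          by (rule continuous_on_subset) (auto simp: A_def)
      qed
      ultimately have "continuous_on A (\<lambda>w. G (replace_coord z i w))"
        by (intro uniform_limit_theorem) auto
      moreover have "w \<in> A"
        using w s by (simp add: A_def)
      ultimately have "continuous (at w within A) (\<lambda>w. G (replace_coord z i w))"
        by (simp add: continuous_on_eq_continuous_within)
      moreover have "at w within A = at w within ?L"
        by (rule at_within_nhd[where S = "{w. s < b $ i \<bullet> w}"])
           (use s in \<open>auto simp: A_def open_halfspace_gt\<close>)
      ultimately show "continuous (at w within ?L) (\<lambda>w. G (replace_coord z i w))"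
        by simp
    qed
  next
    show "G z = g z" if "z \<in> frontier polydisc" for z
      using that by (simp add: G_def)
  qed
  then show ?thesis
    using that lim_G frontier_lim by blast
qed

text \<open>The box is halved, because an extension in the sense of the definition must also be continuous on
  slices at those boundary points that are limits of the inner part of the neighbourhood without
  belonging to it. Such limit points lie in the original box, where continuity in direction \<open>i\<close> is known;
  in the other directions slices through the face stay in the boundary.\<close>

lemma box_extension_imp_extendable_sep_cont:
  assumes F: "box_extension i b r M f F" and f: "continuous_on (frontier polydisc) f"
  shows "extendable_sep_cont f b"
proof -
  define U where "U = touching_box i b (r / 2)"
  define S where "S = (U \<inter> polydisc) \<union> frontier polydisc"
  have U_sub: "U \<subseteq> B"
    using r by (force simp: U_def touching_box_def)
  have hol: "holomorphic_sev_on F (U \<inter> polydisc)"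
    using F U_sub holomorphic_sev_on_subset[of F "B \<inter> polydisc" "U \<inter> polydisc"] by (auto simp: box_extension_def)
  have F_eq: "F z = f z" if "z \<in> frontier polydisc" for z
    using F that by (simp add: box_extension_def)
  have cont_frontier: "continuous_on (frontier polydisc) F"
    using f F_eq by (simp cong: continuous_on_cong)
  have "bounded (F ` frontier polydisc)"
    by (intro compact_imp_bounded compact_continuous_image cont_frontier compact_frontier_polydisc)
  moreover have "bounded (F ` (U \<inter> polydisc))"
    using F U_sub by (auto simp: box_extension_def bounded_iff)
  ultimately have bdd: "bounded (F ` S)"
    by (simp add: S_def image_Un)
  have "separately_continuous_on S F"
    unfolding separately_continuous_on_def continuous_on_def
  proof (intro allI ballI)
    fix z j w0
    define A where "A = {w. replace_coord z j w \<in> U \<inter> polydisc}"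
    define A' where "A' = {w. replace_coord z j w \<in> frontier polydisc}"
    define \<phi> where "\<phi> w = F (replace_coord z j w)" for w
    assume "w0 \<in> {w. replace_coord z j w \<in> S}"
    then have w0: "w0 \<in> A \<union> A'"
      by (auto simp: S_def A_def A'_def)
    have eq: "{w. replace_coord z j w \<in> S} = A \<union> A'"
      by (auto simp: S_def A_def A'_def)
    have "(\<phi> \<longlongrightarrow> \<phi> w0) (at w0 within A \<union> A')"
    proof (cases "w0 \<in> A")
      case True
      then have "replace_coord z j w0 \<in> U \<inter> polydisc"
        by (simp add: A_def)
      then have "isCont F (replace_coord z j w0)"
        using hol unfolding holomorphic_sev_on_def by (meson has_derivative_continuous)
      then have "(\<phi> \<longlongrightarrow> \<phi> w0) (at w0)"
        unfolding \<phi>_def using tendsto_replace_coord by (rule isCont_tendsto_compose)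
      then show ?thesis
        by (rule tendsto_within_subset) simp
    next
      case False
      then have "w0 \<in> A'"
        using w0 by simp
      have "continuous_on A' \<phi>"
        unfolding \<phi>_def
        by (rule continuous_on_compose2[OF cont_frontier continuous_on_replace_coord]) (auto simp: A'_def)
      then have "(\<phi> \<longlongrightarrow> \<phi> w0) (at w0 within A')"
        using \<open>w0 \<in> A'\<close> by (simp add: continuous_on_def)
      moreover have "(\<phi> \<longlongrightarrow> \<phi> w0) (at w0 within A)"
      proof (cases "w0 \<in> closure A")
        case False
        then have "at w0 within A = bot"
          using not_in_closure_trivial_limitI trivial_limit_def by blast
        then show ?thesis by simp
      next
        case True
        let ?p = "replace_coord z j w0"
        \<comment> \<open>a limit of points of the smaller box lies in the larger one\<close>
        define C where "C = {y :: complex ^ 'n. 1 - r / 2 \<le> b $ i \<bullet> y $ i \<and> (\<forall>k. k \<noteq> i \<longrightarrow> dist (b $ k) (y $ k) \<le> r / 2)}"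
        have "closed {y :: complex ^ 'n. k \<noteq> i \<longrightarrow> dist (b $ k) (y $ k) \<le> r / 2}" for k
          by (cases "k = i") (auto intro!: closed_Collect_le continuous_intros)
        then have "closed C"
          unfolding C_def by (intro closed_Collect_conj closed_Collect_all closed_Collect_le continuous_intros)
        then have "closed {w. replace_coord z j w \<in> C}"
          using continuous_on_replace_coord[of UNIV z j] by (metis continuous_closed_vimage continuous_on_eq_continuous_at open_UNIV UNIV_I vimage_def)
        moreover have "A \<subseteq> {w. replace_coord z j w \<in> C}"
          by (auto simp: A_def C_def U_def touching_box_def less_imp_le)
        ultimately have "?p \<in> C"
          using True closure_minimal by blast
        then have pB: "?p \<in> B"
          using r by (force simp: C_def touching_box_def)
        have "?p \<in> frontier polydisc"
          using \<open>w0 \<in> A'\<close> by (simp add: A'_def)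
        then have norm_i: "norm (?p $ i) = 1"
          using pB box_frontier_iff by blast
        show ?thesis
        proof (cases "j = i")
          case False
          \<comment> \<open>here the \<open>i\<close>-th coordinate has modulus one along the whole slice\<close>
          then have "A = {}"
            using norm_i by (auto simp: A_def polydisc_def)
          then show ?thesis by simp
        next
          case True
          let ?L = "lune_with_arc (b $ i) (1 - r)"
          have slice_eq: "replace_coord z j w = replace_coord ?p i w" for w
            by (simp add: True vec_eq_iff)
          have "\<phi> = (\<lambda>w. F (replace_coord ?p i w))"
            unfolding \<phi>_def by (intro ext arg_cong[where f = F] slice_eq)
          then have "continuous_on ?L \<phi>"
            using F pB by (simp add: box_extension_def)
          moreover have "w0 \<in> ?L"
            using pB norm_i True by (simp add: lune_with_arc_def touching_box_def)
          ultimately have "(\<phi> \<longlongrightarrow> \<phi> w0) (at w0 within ?L)"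
            by (simp add: continuous_on_def)
          then show ?thesis
          proof (rule tendsto_within_subset)
            show "A \<subseteq> ?L"
            proof
              fix w assume "w \<in> A"
              then have "replace_coord z j w \<in> B" "replace_coord z j w \<in> polydisc"
                using U_sub by (auto simp: A_def)
              then show "w \<in> ?L"
                using box_polydisc_iff[of "replace_coord z j w"] True
                by (auto simp: touching_box_def lune_with_arc_def)
            qed
          qed
        qed
      qed
      ultimately show ?thesis
        by (simp add: Lim_Un)
    qed
    then show "((\<lambda>w. F (replace_coord z j w)) \<longlongrightarrow> F (replace_coord z j w0))
        (at w0 within {w. replace_coord z j w \<in> S})"
      unfolding \<phi>_def eq .
  qed
  moreover have "b \<in> U"
    using r unit by (simp add: U_def touching_box_def norm_eq_1)
  ultimately show ?thesis
    unfolding extendable_sep_cont_def one_side_extendable_def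
    using bdd hol F_eq open_touching_box[of "r / 2"] unfolding S_def U_def by blast
qed

lemma extension_imp_box_extension:
  assumes sub: "B \<inter> polydisc \<subseteq> U"
    and bdd: "bounded (F ` ((U \<inter> polydisc) \<union> frontier polydisc))"
    and cont: "separately_continuous_on ((U \<inter> polydisc) \<union> frontier polydisc) F"
    and hol: "holomorphic_sev_on F (U \<inter> polydisc)"
    and F: "\<And>z. z \<in> frontier polydisc \<Longrightarrow> F z = f z"
  obtains M where "\<And>M'. M \<le> M' \<Longrightarrow> box_extension i b r M' f F"
proof -
  obtain M where M: "\<And>z. z \<in> (U \<inter> polydisc) \<union> frontier polydisc \<Longrightarrow> norm (F z) \<le> M"
    using bdd by (meson bounded_iff image_eqI)
  have "box_extension i b r M' f F" if "M \<le> M'" for M'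
    unfolding box_extension_def
  proof (intro conjI ballI)
    show "holomorphic_sev_on F (B \<inter> polydisc)"
      using hol sub holomorphic_sev_on_subset by blast
    show "norm (F z) \<le> M'" if "z \<in> B \<inter> polydisc" for z
      using M[of z] sub that \<open>M \<le> M'\<close> by force
    fix z assume z: "z \<in> B"
    show "continuous_on (lune_with_arc (b $ i) (1 - r)) (\<lambda>w. F (replace_coord z i w))"
    proof (rule continuous_on_subset)
      show "continuous_on {w. replace_coord z i w \<in> (U \<inter> polydisc) \<union> frontier polydisc} (\<lambda>w. F (replace_coord z i w))"
        using cont by (auto simp: separately_continuous_on_def)
      show "lune_with_arc (b $ i) (1 - r) \<subseteq> {w. replace_coord z i w \<in> (U \<inter> polydisc) \<union> frontier polydisc}"
      proof
        fix w assume w: "w \<in> lune_with_arc (b $ i) (1 - r)"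
        show "w \<in> {w. replace_coord z i w \<in> (U \<inter> polydisc) \<union> frontier polydisc}"
        proof (cases "norm w = 1")
          case True
          then show ?thesis
            using slice_frontier[OF z True] w by (auto simp: lune_with_arc_def)
        next
          case False
          then have "w \<in> open_lune (b $ i) (1 - r)"
            using w by (auto simp: lune_with_arc_def open_lune_def)
          then show ?thesis
            using slice_polydisc[OF z] sub by auto
        qed
      qed
    qed
  qed (use F in auto)
  then show ?thesis
    using that by blast
qed

text \<open>It suffices to look at the slice through the centre of the box.\<close>

lemma kink_perturbation_not_box_extendable:
  assumes F: "box_extension i b r M f F" and G: "box_extension i b r M' g G"
    and g: "\<And>z. z \<in> frontier polydisc \<Longrightarrow> g z = f z + of_real (e * max 0 (1 - r / 2 - b $ i \<bullet> z $ i))"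
  shows "e = 0"
proof (rule ccontr)
  assume "e \<noteq> 0"
  define h where "h w = G (replace_coord b i w) - F (replace_coord b i w)" for w
  show False
  proof (rule kink_not_boundary_value[OF unit, of "1 - r" "1 - r / 2" e h])
    show "continuous_on (lune_with_arc (b $ i) (1 - r)) h"
      unfolding h_def using F G center by (intro continuous_on_diff) (auto simp: box_extension_def)
    show "h holomorphic_on open_lune (b $ i) (1 - r)"
      unfolding h_def using F G center
      by (intro holomorphic_on_diff holomorphic_slice) (auto simp: box_extension_def)
    show "h w = of_real (e * max 0 (1 - r / 2 - b $ i \<bullet> w))" if "norm w = 1" "1 - r < b $ i \<bullet> w" for w
      using F G g slice_frontier[OF center(1) that] by (simp add: h_def box_extension_def)
  qed (use r \<open>e \<noteq> 0\<close> in auto)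
qed

end

text \<open>Every boundary point has some coordinate \<open>i\<close> of modulus one. The centre of the box keeps this
  coordinate, while all others are multiplied by \<open>1 - r\<close> to leave room for discs of radius \<open>r\<close>
  inside the unit disc.\<close>

lemma exists_admissible_box:
  fixes \<zeta> :: "complex ^ 'n"
  assumes \<zeta>: "\<zeta> \<in> frontier polydisc" and U: "open U" "\<zeta> \<in> U"
  obtains i b r where "admissible_box i b r" "touching_box i b r \<inter> polydisc \<subseteq> U"
proof -
  obtain i where le1: "\<And>j. norm (\<zeta> $ j) \<le> 1" and i: "norm (\<zeta> $ i) = 1"
    using \<zeta> by (auto simp: frontier_polydisc)
  obtain \<rho> where "\<rho> > 0" and \<rho>: "ball \<zeta> \<rho> \<subseteq> U"
    using U open_contains_ball by blast
  define \<delta> where "\<delta> = \<rho> / CARD('n)"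
  have "\<delta> > 0"
    using \<open>\<rho> > 0\<close> by (simp add: \<delta>_def)
  \<comment> \<open>in the lune, \<open>\<bar>z\<^sub>i - \<zeta>\<^sub>i\<bar>\<^sup>2 \<le> 2 * r\<close>; the other coordinates move by less than \<open>2 * r\<close>, which is at most \<open>sqrt (2 * r)\<close>\<close>
  define r where "r = min (1 / 2) (\<delta>\<^sup>2 / 4)"
  have r: "0 < r" "r \<le> 1 / 2" "r \<le> \<delta>\<^sup>2 / 4"
    using \<open>\<delta> > 0\<close> by (auto simp: r_def)
  have "0 < \<delta>\<^sup>2"
    using \<open>\<delta> > 0\<close> by simp
  then have "2 * r < \<delta>\<^sup>2"
    using r by linarith
  then have sqrt_r: "sqrt (2 * r) < \<delta>"
    using \<open>\<delta> > 0\<close> r by (simp add: real_sqrt_less_iff real_less_lsqrt)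
  have "(2 * r)\<^sup>2 \<le> 2 * r"
    using r by (simp add: power2_eq_square)
  then have two_r: "2 * r \<le> sqrt (2 * r)"
    using r by (intro real_le_rsqrt) auto
  define b where "b = (\<chi> j. if j = i then \<zeta> $ i else of_real (1 - r) * \<zeta> $ j)"
  have b: "b $ i = \<zeta> $ i" "\<And>j. j \<noteq> i \<Longrightarrow> b $ j = of_real (1 - r) * \<zeta> $ j"
    by (auto simp: b_def)
  have norm_b: "norm (b $ j) = (1 - r) * norm (\<zeta> $ j)" if "j \<noteq> i" for j
    unfolding b(2)[OF that] norm_mult norm_of_real using r by simp
  have "admissible_box i b r"
  proof
    show "norm (b $ j) + r \<le> 1" if "j \<noteq> i" for j
    proof -
      have "(1 - r) * norm (\<zeta> $ j) \<le> (1 - r) * 1"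
        using r by (intro mult_left_mono le1) simp
      then show ?thesis
        by (simp add: norm_b that)
    qed
  qed (use r b i in auto)
  moreover have "touching_box i b r \<inter> polydisc \<subseteq> U"
  proof
    fix z assume z: "z \<in> touching_box i b r \<inter> polydisc"
    have "dist (\<zeta> $ j) (z $ j) < \<delta>" for j
    proof (cases "j = i")
      case True
      have "norm (z $ i) \<le> 1"
        using z by (simp add: polydisc_def less_imp_le)
      then have "(norm (z $ i))\<^sup>2 \<le> 1"
        by (simp add: power_le_one)
      moreover have "(dist (\<zeta> $ i) (z $ i))\<^sup>2 = (norm (\<zeta> $ i))\<^sup>2 + (norm (z $ i))\<^sup>2 - 2 * (\<zeta> $ i \<bullet> z $ i)"
        by (simp add: dist_norm power2_norm_eq_inner inner_diff_left inner_diff_right inner_commute)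
      moreover have "1 - r < \<zeta> $ i \<bullet> z $ i"
        using z b by (simp add: touching_box_def)
      ultimately have "(dist (\<zeta> $ i) (z $ i))\<^sup>2 \<le> 2 * r"
        using i by simp
      then have "dist (\<zeta> $ i) (z $ i) \<le> sqrt (2 * r)"
        by (simp add: real_le_rsqrt)
      then show ?thesis
        using sqrt_r True by simp
    next
      case False
      have "\<zeta> $ j - b $ j = of_real r * \<zeta> $ j"
        by (simp add: b(2)[OF False] algebra_simps)
      then have "dist (\<zeta> $ j) (b $ j) = r * norm (\<zeta> $ j)"
        using r by (simp add: dist_norm norm_mult)
      also have "\<dots> \<le> r"
        using le1[of j] r by (simp add: mult_left_le)
      finally have "dist (\<zeta> $ j) (b $ j) \<le> r" .
      moreover have "dist (b $ j) (z $ j) < r"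
        using z False by (simp add: touching_box_def)
      ultimately have "dist (\<zeta> $ j) (z $ j) < 2 * r"
        using dist_triangle[of "\<zeta> $ j" "z $ j" "b $ j"] by simp
      then show ?thesis
        using two_r sqrt_r by simp
    qed
    then have "(\<Sum>j\<in>UNIV. dist (\<zeta> $ j) (z $ j)) < (\<Sum>j\<in>(UNIV :: 'n set). \<delta>)"
      by (intro sum_strict_mono) auto
    moreover have "dist \<zeta> z \<le> (\<Sum>j\<in>UNIV. dist (\<zeta> $ j) (z $ j))"
      unfolding dist_vec_def by (rule L2_set_le_sum) simp
    ultimately have "dist \<zeta> z < \<rho>"
      by (simp add: \<delta>_def)
    then show "z \<in> U"
      using \<rho> by auto
  qed
  ultimately show ?thesis
    using that by blast
qed

text \<open>One box is chosen inside each member of a countable base that meets the boundary.\<close>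

lemma countable_admissible_boxes:
  obtains \<P> :: "('n :: finite \<times> (complex ^ 'n) \<times> real) set"
  where "countable \<P>" "\<And>i b r. (i, b, r) \<in> \<P> \<Longrightarrow> admissible_box i b r"
    "\<And>\<zeta> U. \<lbrakk>\<zeta> \<in> frontier polydisc; open U; \<zeta> \<in> U\<rbrakk> \<Longrightarrow> \<exists>(i, b, r)\<in>\<P>. touching_box i b r \<inter> polydisc \<subseteq> U"
proof -
  obtain \<B> :: "(complex ^ 'n) set set" where "countable \<B>"
    and open_\<B>: "\<And>C. C \<in> \<B> \<Longrightarrow> open C" and base: "\<And>S. open S \<Longrightarrow> \<exists>\<U>. \<U> \<subseteq> \<B> \<and> S = \<Union>\<U>"
    using univ_second_countable by metis
  define \<C> where "\<C> = {C \<in> \<B>. C \<inter> frontier polydisc \<noteq> {}}"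
  have "\<forall>C\<in>\<C>. \<exists>p. admissible_box (fst p) (fst (snd p)) (snd (snd p)) \<and> touching_box (fst p) (fst (snd p)) (snd (snd p)) \<inter> polydisc \<subseteq> C"
  proof
    fix C assume "C \<in> \<C>"
    then obtain \<zeta> where "\<zeta> \<in> frontier polydisc" "open C" "\<zeta> \<in> C"
      using open_\<B> by (auto simp: \<C>_def)
    then obtain i b r where "admissible_box i b r" "touching_box i b r \<inter> polydisc \<subseteq> C"
      using exists_admissible_box by blast
    then show "\<exists>p. admissible_box (fst p) (fst (snd p)) (snd (snd p)) \<and> touching_box (fst p) (fst (snd p)) (snd (snd p)) \<inter> polydisc \<subseteq> C"
      by (intro exI[of _ "(i, b, r)"]) simp
  qed
  then obtain p where p: "\<And>C. C \<in> \<C> \<Longrightarrow> admissible_box (fst (p C)) (fst (snd (p C))) (snd (snd (p C)))"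
    "\<And>C. C \<in> \<C> \<Longrightarrow> touching_box (fst (p C)) (fst (snd (p C))) (snd (snd (p C))) \<inter> polydisc \<subseteq> C"
    by metis
  show ?thesis
  proof (rule that[of "p ` \<C>"])
    show "countable (p ` \<C>)"
      using \<open>countable \<B>\<close> by (simp add: \<C>_def)
    show "admissible_box i b r" if pC: "(i, b, r) \<in> p ` \<C>" for i b r
    proof -
      obtain C where C: "C \<in> \<C>" "(i, b, r) = p C"
        using pC by blast
      then show ?thesis
        using p(1)[OF C(1)] by (simp flip: C(2))
    qed
    fix \<zeta> :: "complex ^ 'n" and U assume \<zeta>: "\<zeta> \<in> frontier polydisc" "open U" "\<zeta> \<in> U"
    then obtain C where C: "C \<in> \<B>" "\<zeta> \<in> C" "C \<subseteq> U"
      using base[OF \<open>open U\<close>] by blast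
    then have "C \<in> \<C>"
      using \<zeta> by (auto simp: \<C>_def)
    then show "\<exists>(i, b, r)\<in>p ` \<C>. touching_box i b r \<inter> polydisc \<subseteq> U"
      using p(2)[OF \<open>C \<in> \<C>\<close>] C by (intro bexI[of _ "p C"]) (auto simp: case_prod_unfold)
  qed
qed

section \<open>Comparison of the three notions of extension\<close>

text \<open>The definition of separately continuous extension asks for boundedness, which a continuous
  extension has near \<open>\<zeta>\<close> and, by compactness, on the boundary.\<close>

lemma continuous_extension_locally_bounded:
  assumes U: "open U" "\<zeta> \<in> U" and \<zeta>: "\<zeta> \<in> frontier polydisc"
    and cont: "continuous_on ((U \<inter> polydisc) \<union> frontier polydisc) F"
  obtains V where "open V" "\<zeta> \<in> V" "V \<subseteq> U" "bounded (F ` ((V \<inter> polydisc) \<union> frontier polydisc))"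
proof -
  let ?S = "(U \<inter> polydisc) \<union> frontier polydisc"
  have "\<zeta> \<in> ?S" using \<zeta> by simp
  then obtain d where "d > 0" and d: "\<And>z. \<lbrakk>z \<in> ?S; dist z \<zeta> < d\<rbrakk> \<Longrightarrow> dist (F z) (F \<zeta>) < 1"
    using cont unfolding continuous_on_iff by (metis zero_less_one)
  have "F ` (U \<inter> ball \<zeta> d \<inter> polydisc) \<subseteq> ball (F \<zeta>) 1"
    using d by (auto simp: dist_commute)
  then have "bounded (F ` (U \<inter> ball \<zeta> d \<inter> polydisc))"
    using bounded_subset bounded_ball by blast
  moreover have "bounded (F ` frontier polydisc)"
    by (intro compact_imp_bounded compact_continuous_image compact_frontier_polydisc
        continuous_on_subset[OF cont]) auto
  ultimately show ?thesis
    using U \<open>d > 0\<close> by (intro that[of "U \<inter> ball \<zeta> d"]) (auto simp: image_Un)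
qed

lemma separately_continuous_on_if_continuous_on:
  "continuous_on S F \<Longrightarrow> separately_continuous_on S F"
  unfolding separately_continuous_on_def
  by (intro allI, rule continuous_on_compose2[OF _ continuous_on_replace_coord]) auto

lemma extendable_usual_imp_sep_cont:
  assumes "extendable_usual f \<zeta>" and \<zeta>: "\<zeta> \<in> frontier polydisc"
  shows "extendable_sep_cont f \<zeta>"
proof -
  obtain U F where U: "open U" "\<zeta> \<in> U" and cont: "continuous_on ((U \<inter> polydisc) \<union> frontier polydisc) F"
    and hol: "holomorphic_sev_on F (U \<inter> polydisc)" and F: "\<forall>z\<in>frontier polydisc. F z = f z"
    using assms unfolding extendable_usual_def one_side_extendable_def by blast
  obtain V where V: "open V" "\<zeta> \<in> V" "V \<subseteq> U" and bdd: "bounded (F ` ((V \<inter> polydisc) \<union> frontier polydisc))"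
    by (rule continuous_extension_locally_bounded[OF U \<zeta> cont])
  have sub: "(V \<inter> polydisc) \<union> frontier polydisc \<subseteq> (U \<inter> polydisc) \<union> frontier polydisc"
    using V by auto
  then have sep: "separately_continuous_on ((V \<inter> polydisc) \<union> frontier polydisc) F"
    by (intro separately_continuous_on_if_continuous_on continuous_on_subset[OF cont])
  have hol: "holomorphic_sev_on F (V \<inter> polydisc)"
    using hol V holomorphic_sev_on_subset[of F "U \<inter> polydisc" "V \<inter> polydisc"] by blast
  show ?thesis
    unfolding extendable_sep_cont_def one_side_extendable_def
    using V bdd sep hol F by blast
qed

lemma extendable_lipschitz_imp_usual: "extendable_lipschitz f \<zeta> \<Longrightarrow> extendable_usual f \<zeta>"
  unfolding extendable_lipschitz_def extendable_usual_def one_side_extendable_def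
  using lipschitz_on_continuous_on by blast

section \<open>The space of continuous functions on the boundary\<close>

interpretation boundary: Metric_space "mspace boundary_cfunspace" "mdist boundary_cfunspace"
  by (rule Metric_space_mspace_mdist)

lemma mtopology_boundary: "mtopology_of boundary_cfunspace = boundary.mtopology"
  by (simp add: mtopology_of_def)

lemma dist_le_mdist_boundary:
  assumes "f \<in> mspace boundary_cfunspace" "g \<in> mspace boundary_cfunspace" "z \<in> frontier polydisc"
  shows "dist (f z) (g z) \<le> mdist boundary_cfunspace f g"
  using mdist_cfunspace_imp_mdist_le[of f "top_of_set (frontier polydisc)" euclidean_metric g _ z] assms
  unfolding boundary_cfunspace_def by auto

lemma mdist_boundary_le:
  assumes "0 \<le> e" "\<And>z. z \<in> frontier polydisc \<Longrightarrow> dist (f z) (g z) \<le> e"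
  shows "mdist boundary_cfunspace f g \<le> e"
  unfolding boundary_cfunspace_def using assms by (intro mdist_cfunspace_le) auto

lemma limitin_boundary_imp_uniform_limit:
  assumes \<sigma>: "range \<sigma> \<subseteq> mspace boundary_cfunspace" and lim: "limitin boundary.mtopology \<sigma> f sequentially"
  shows "uniform_limit (frontier polydisc) \<sigma> f sequentially"
proof (rule uniform_limitI)
  fix e :: real assume "e > 0"
  then have f: "f \<in> mspace boundary_cfunspace"
    and ev: "\<forall>\<^sub>F k in sequentially. \<sigma> k \<in> mspace boundary_cfunspace \<and> mdist boundary_cfunspace (\<sigma> k) f < e"
    using lim by (auto simp: boundary.limitin_metric)
  from ev show "\<forall>\<^sub>F k in sequentially. \<forall>z\<in>frontier polydisc. dist (\<sigma> k z) (f z) < e"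
    by eventually_elim (use f dist_le_mdist_boundary in \<open>blast intro: le_less_trans\<close>)
qed

lemma complete_boundary:
  "completely_metrizable_space (mtopology_of (boundary_cfunspace :: (complex ^ 'n \<Rightarrow> complex) metric))"
proof -
  have "mcomplete_of (cfunspace (top_of_set (frontier (polydisc :: (complex ^ 'n) set))) (Met_TC.Self :: complex metric))"
    by (rule Met_TC.mcomplete_cfunspace) (simp add: complete_UNIV)
  then have "mcomplete_of (boundary_cfunspace :: (complex ^ 'n \<Rightarrow> complex) metric)"
    unfolding boundary_cfunspace_def euclidean_metric_def Met_TC.Self_def .
  then show ?thesis
    unfolding mtopology_boundary mcomplete_of_def by (rule boundary.completely_metrizable_space_mtopology)
qed

section \<open>The closed sets of functions extendable to a given box\<close>

definition box_extendable :: "'n \<Rightarrow> complex ^ 'n \<Rightarrow> real \<Rightarrow> real \<Rightarrow> (complex ^ 'n \<Rightarrow> complex) set" where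
  "box_extendable i b r M = {f \<in> mspace boundary_cfunspace. \<exists>F. box_extension i b r M f F}"

definition lipschitz_box_extendable :: "'n \<Rightarrow> complex ^ 'n \<Rightarrow> real \<Rightarrow> real \<Rightarrow> (complex ^ 'n \<Rightarrow> complex) set" where
  "lipschitz_box_extendable i b r M = {f \<in> mspace boundary_cfunspace. \<exists>F. box_extension i b r M f F \<and>
     M-lipschitz_on ((touching_box i b r \<inter> polydisc) \<union> frontier polydisc) F}"

context admissible_box
begin

lemma closedin_box_extendable: "closedin (mtopology_of boundary_cfunspace) (box_extendable i b r M)"
  unfolding mtopology_boundary boundary.metric_closedin_iff_sequentially_closed
proof (intro conjI allI impI)
  fix \<sigma> f assume \<sigma>: "range \<sigma> \<subseteq> box_extendable i b r M \<and> limitin boundary.mtopology \<sigma> f sequentially"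
  then have f: "f \<in> mspace boundary_cfunspace"
    by (auto simp: boundary.limitin_metric)
  have "uniform_limit (frontier polydisc) \<sigma> f sequentially"
    using \<sigma> by (intro limitin_boundary_imp_uniform_limit) (auto simp: box_extendable_def)
  moreover have "\<forall>k. \<exists>F. box_extension i b r M (\<sigma> k) F"
    using \<sigma> by (auto simp: box_extendable_def image_subset_iff)
  then obtain F where "\<And>k. box_extension i b r M (\<sigma> k) (F k)"
    by metis
  ultimately obtain G where "box_extension i b r M f G"
    using box_extension_limit by metis
  then show "f \<in> box_extendable i b r M"
    using f by (auto simp: box_extendable_def)
qed (auto simp: box_extendable_def)

lemma closedin_lipschitz_box_extendable:
  "closedin (mtopology_of boundary_cfunspace) (lipschitz_box_extendable i b r M)"
  unfolding mtopology_boundary boundary.metric_closedin_iff_sequentially_closed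
proof (intro conjI allI impI)
  let ?S = "(B \<inter> polydisc) \<union> frontier polydisc"
  fix \<sigma> f assume \<sigma>: "range \<sigma> \<subseteq> lipschitz_box_extendable i b r M \<and> limitin boundary.mtopology \<sigma> f sequentially"
  then have f: "f \<in> mspace boundary_cfunspace"
    by (auto simp: boundary.limitin_metric)
  have unif: "uniform_limit (frontier polydisc) \<sigma> f sequentially"
    using \<sigma> by (intro limitin_boundary_imp_uniform_limit) (auto simp: lipschitz_box_extendable_def)
  have "\<forall>k. \<exists>F. box_extension i b r M (\<sigma> k) F \<and> M-lipschitz_on ?S F"
    using \<sigma> by (auto simp: lipschitz_box_extendable_def image_subset_iff)
  then obtain F where F: "\<And>k. box_extension i b r M (\<sigma> k) (F k)" and lip: "\<And>k. M-lipschitz_on ?S (F k)"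
    by metis
  obtain G where G: "box_extension i b r M f G" and lim: "\<And>z. z \<in> ?S \<Longrightarrow> (\<lambda>k. F k z) \<longlonglongrightarrow> G z"
    using box_extension_limit[OF F unif] by blast
  have "M-lipschitz_on ?S G"
  proof (rule lipschitz_onI)
    fix x y assume xy: "x \<in> ?S" "y \<in> ?S"
    show "dist (G x) (G y) \<le> M * dist x y"
    proof (rule tendsto_upperbound[OF tendsto_dist[OF lim[OF xy(1)] lim[OF xy(2)]]])
      show "\<forall>\<^sub>F k in sequentially. dist (F k x) (F k y) \<le> M * dist x y"
        using lipschitz_onD[OF lip xy] by (intro always_eventually) blast
    qed simp
  qed (use lipschitz_on_nonneg[OF lip] in blast)
  then show "f \<in> lipschitz_box_extendable i b r M"
    using f G by (auto simp: lipschitz_box_extendable_def)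
qed (auto simp: lipschitz_box_extendable_def)

text \<open>A ball around \<open>f\<close> would also contain a sum of \<open>f\<close> and a small multiple of the kink function.\<close>

lemma interior_box_extendable: "mtopology_of boundary_cfunspace interior_of (box_extendable i b r M) = {}"
proof (rule ccontr)
  assume "\<not> ?thesis"
  then obtain f where f: "f \<in> boundary.mtopology interior_of (box_extendable i b r M)"
    unfolding mtopology_boundary by blast
  then obtain \<epsilon> where "\<epsilon> > 0" and \<epsilon>: "boundary.mball f \<epsilon> \<subseteq> box_extendable i b r M"
    using boundary.metric_interior_of by blast
  have fM: "f \<in> mspace boundary_cfunspace" and "f \<in> box_extendable i b r M"
    using f interior_of_subset by (fastforce simp: box_extendable_def)+
  then obtain F where F: "box_extension i b r M f F"
    by (auto simp: box_extendable_def)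
  \<comment> \<open>the kink function is bounded by \<open>2\<close>, so the perturbation has norm at most \<open>\<epsilon> / 2\<close>\<close>
  define e where "e = \<epsilon> / 4"
  have "e > 0" using \<open>\<epsilon> > 0\<close> by (simp add: e_def)
  define g where "g = restrict (\<lambda>z. f z + of_real (e * max 0 (1 - r / 2 - b $ i \<bullet> z $ i))) (frontier polydisc)"
  have g_eq: "g z = f z + of_real (e * max 0 (1 - r / 2 - b $ i \<bullet> z $ i))" if "z \<in> frontier polydisc" for z
    using that by (simp add: g_def)
  have "continuous_on (frontier polydisc) (\<lambda>z. f z + of_real (e * max 0 (1 - r / 2 - b $ i \<bullet> z $ i)))"
    using fM by (intro continuous_intros) (auto simp: mspace_boundary_cfunspace)
  then have gM: "g \<in> mspace boundary_cfunspace"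
    using g_eq by (auto simp: mspace_boundary_cfunspace g_def cong: continuous_on_cong)
  have "mdist boundary_cfunspace f g \<le> 2 * e"
  proof (rule mdist_boundary_le)
    fix z :: "complex ^ 'n" assume z: "z \<in> frontier polydisc"
    have "- (b $ i \<bullet> z $ i) \<le> norm (b $ i) * norm (z $ i)"
      using norm_cauchy_schwarz[of "- b $ i" "z $ i"] by simp
    also have "\<dots> \<le> 1"
      using z unit by (simp add: frontier_polydisc)
    finally have "max 0 (1 - r / 2 - b $ i \<bullet> z $ i) \<le> 2"
      using r by simp
    then have "e * max 0 (1 - r / 2 - b $ i \<bullet> z $ i) \<le> e * 2"
      using \<open>e > 0\<close> by (intro mult_left_mono) auto
    moreover have "0 \<le> e * max 0 (1 - r / 2 - b $ i \<bullet> z $ i)"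
      using \<open>e > 0\<close> by simp
    moreover have "dist (f z) (g z) = \<bar>e * max 0 (1 - r / 2 - b $ i \<bullet> z $ i)\<bar>"
      unfolding g_eq[OF z] dist_norm by (metis add_diff_cancel_left' norm_minus_commute norm_of_real)
    ultimately show "dist (f z) (g z) \<le> 2 * e"
      by linarith
  qed (use \<open>e > 0\<close> in simp)
  also have "\<dots> < \<epsilon>"
    using \<open>\<epsilon> > 0\<close> by (simp add: e_def)
  finally have "g \<in> box_extendable i b r M"
    using \<epsilon> fM gM by (auto simp: boundary.in_mball)
  then obtain G where "box_extension i b r M g G"
    by (auto simp: box_extendable_def)
  then have "e = 0"
    using kink_perturbation_not_box_extendable[OF F _ g_eq] by blast
  then show False
    using \<open>e > 0\<close> by simp
qed

lemma box_extendable_imp: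
  assumes "f \<in> box_extendable i b r M"
  shows "\<exists>\<zeta>\<in>frontier polydisc. extendable_sep_cont f \<zeta>"
  using assms center box_extension_imp_extendable_sep_cont
  by (auto simp: box_extendable_def mspace_boundary_cfunspace)

lemma lipschitz_box_extendable_imp:
  assumes "f \<in> lipschitz_box_extendable i b r M"
  shows "\<exists>\<zeta>\<in>frontier polydisc. extendable_lipschitz f \<zeta>"
  using assms center open_touching_box[of r]
  unfolding lipschitz_box_extendable_def box_extension_def extendable_lipschitz_def one_side_extendable_def
  by blast

end

section \<open>Assembling the countable union\<close>

lemma gdelta_in_complement_countable_Union_closed:
  assumes "countable I" "\<And>i. i \<in> I \<Longrightarrow> closedin X (C i)"
  shows "gdelta_in X (topspace X - (\<Union>i\<in>I. C i))"
proof -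
  have "fsigma_in X (\<Union>i\<in>I. C i)"
    using assms by (intro fsigma_in_Union) (auto intro: closed_imp_fsigma_in)
  moreover have "(\<Union>i\<in>I. C i) \<subseteq> topspace X"
    using assms closedin_subset by blast
  ultimately show ?thesis
    by (simp add: gdelta_in_fsigma_in double_diff)
qed

lemma nowhere_ext_eq_complement:
  assumes "\<And>f. f \<in> mspace boundary_cfunspace \<Longrightarrow> (\<exists>\<zeta>\<in>frontier polydisc. E f \<zeta>) \<longleftrightarrow> f \<in> T"
  shows "nowhere_ext E = topspace (mtopology_of boundary_cfunspace) - T"
  using assms by (auto simp: nowhere_ext_def)

theorem theorem21:
  shows "dense_gdelta_in (mtopology_of boundary_cfunspace)
           (nowhere_ext (extendable_sep_cont :: (complex ^ 'n \<Rightarrow> complex) \<Rightarrow> complex ^ 'n \<Rightarrow> bool))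
       \<and> residual_in (mtopology_of boundary_cfunspace)
           (nowhere_ext (extendable_usual :: (complex ^ 'n \<Rightarrow> complex) \<Rightarrow> complex ^ 'n \<Rightarrow> bool))
       \<and> dense_gdelta_in (mtopology_of boundary_cfunspace)
           (nowhere_ext (extendable_lipschitz :: (complex ^ 'n \<Rightarrow> complex) \<Rightarrow> complex ^ 'n \<Rightarrow> bool))"
proof -
  let ?X = "mtopology_of (boundary_cfunspace :: (complex ^ 'n \<Rightarrow> complex) metric)"
  let ?sep = "nowhere_ext (extendable_sep_cont :: (complex ^ 'n \<Rightarrow> complex) \<Rightarrow> _)"
  let ?usual = "nowhere_ext (extendable_usual :: (complex ^ 'n \<Rightarrow> complex) \<Rightarrow> _)"
  let ?lip = "nowhere_ext (extendable_lipschitz :: (complex ^ 'n \<Rightarrow> complex) \<Rightarrow> _)"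
  obtain \<P> :: "('n \<times> (complex ^ 'n) \<times> real) set" where "countable \<P>"
    and adm: "\<And>i b r. (i, b, r) \<in> \<P> \<Longrightarrow> admissible_box i b r"
    and fine: "\<And>\<zeta> U. \<lbrakk>\<zeta> \<in> frontier polydisc; open U; \<zeta> \<in> U\<rbrakk> \<Longrightarrow> \<exists>(i, b, r)\<in>\<P>. touching_box i b r \<inter> polydisc \<subseteq> U"
    using countable_admissible_boxes by blast
  define I where "I = \<P> \<times> (UNIV :: nat set)"
  have "countable I"
    using \<open>countable \<P>\<close> by (simp add: I_def)
  define C where "C = (\<lambda>((i, b, r), m :: nat). box_extendable i b r (real m) :: (complex ^ 'n \<Rightarrow> complex) set)"
  define L where "L = (\<lambda>((i, b, r), m :: nat). lipschitz_box_extendable i b r (real m) :: (complex ^ 'n \<Rightarrow> complex) set)"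
  have closed: "closedin ?X (C p)" "?X interior_of (C p) = {}" "closedin ?X (L p)" if "p \<in> I" for p
  proof -
    obtain i b r m where p: "p = ((i, b, r), m)" "(i, b, r) \<in> \<P>"
      using \<open>p \<in> I\<close> by (auto simp: I_def)
    interpret admissible_box i b r
      by (rule adm[OF p(2)])
    show "closedin ?X (C p)" "?X interior_of (C p) = {}" "closedin ?X (L p)"
      by (simp_all add: p(1) C_def L_def closedin_box_extendable interior_box_extendable
          closedin_lipschitz_box_extendable)
  qed
  have sep_iff: "(\<exists>\<zeta>\<in>frontier polydisc. extendable_sep_cont f \<zeta>) \<longleftrightarrow> f \<in> (\<Union>p\<in>I. C p)"
    if f: "f \<in> mspace boundary_cfunspace" for f
  proof
    assume "\<exists>\<zeta>\<in>frontier polydisc. extendable_sep_cont f \<zeta>"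
    then obtain \<zeta> U F where \<zeta>: "\<zeta> \<in> frontier polydisc" "open U" "\<zeta> \<in> U"
      and F: "bounded (F ` ((U \<inter> polydisc) \<union> frontier polydisc))"
        "separately_continuous_on ((U \<inter> polydisc) \<union> frontier polydisc) F"
        "holomorphic_sev_on F (U \<inter> polydisc)" "\<And>z. z \<in> frontier polydisc \<Longrightarrow> F z = f z"
      unfolding extendable_sep_cont_def one_side_extendable_def by blast
    obtain i b r where ibr: "(i, b, r) \<in> \<P>" "touching_box i b r \<inter> polydisc \<subseteq> U"
      using fine[OF \<zeta>] by blast
    obtain M where M: "\<And>M'. M \<le> M' \<Longrightarrow> box_extension i b r M' f F"
      using admissible_box.extension_imp_box_extension[OF adm[OF ibr(1)] ibr(2) F] by blast
    obtain m :: nat where "M \<le> real m"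
      using real_arch_simple by blast
    then have "f \<in> C ((i, b, r), m)"
      using M f by (auto simp: C_def box_extendable_def)
    then show "f \<in> (\<Union>p\<in>I. C p)"
      using ibr by (auto simp: I_def)
  next
    assume "f \<in> (\<Union>p\<in>I. C p)"
    then obtain i b r m where "(i, b, r) \<in> \<P>" "f \<in> box_extendable i b r (real m)"
      by (auto simp: I_def C_def)
    then show "\<exists>\<zeta>\<in>frontier polydisc. extendable_sep_cont f \<zeta>"
      using adm admissible_box.box_extendable_imp by blast
  qed
  have lip_iff: "(\<exists>\<zeta>\<in>frontier polydisc. extendable_lipschitz f \<zeta>) \<longleftrightarrow> f \<in> (\<Union>p\<in>I. L p)"
    if f: "f \<in> mspace boundary_cfunspace" for f
  proof
    assume "\<exists>\<zeta>\<in>frontier polydisc. extendable_lipschitz f \<zeta>"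
    then obtain \<zeta> U0 F K where \<zeta>: "\<zeta> \<in> frontier polydisc" "open U0" "\<zeta> \<in> U0"
      and lip0: "K-lipschitz_on ((U0 \<inter> polydisc) \<union> frontier polydisc) F"
      and hol0: "holomorphic_sev_on F (U0 \<inter> polydisc)" and F: "\<And>z. z \<in> frontier polydisc \<Longrightarrow> F z = f z"
      unfolding extendable_lipschitz_def one_side_extendable_def by blast
    obtain U where U: "open U" "\<zeta> \<in> U" "U \<subseteq> U0" and bdd: "bounded (F ` ((U \<inter> polydisc) \<union> frontier polydisc))"
      by (rule continuous_extension_locally_bounded[OF \<zeta>(2,3,1) lipschitz_on_continuous_on[OF lip0]])
    have lip: "K-lipschitz_on ((U \<inter> polydisc) \<union> frontier polydisc) F"
      by (rule lipschitz_on_subset[OF lip0]) (use U in auto)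
    have hol: "holomorphic_sev_on F (U \<inter> polydisc)"
      by (rule holomorphic_sev_on_subset[OF hol0]) (use U in auto)
    have sep: "separately_continuous_on ((U \<inter> polydisc) \<union> frontier polydisc) F"
      by (intro separately_continuous_on_if_continuous_on lipschitz_on_continuous_on[OF lip])
    obtain i b r where ibr: "(i, b, r) \<in> \<P>" "touching_box i b r \<inter> polydisc \<subseteq> U"
      using fine[OF \<zeta>(1) U(1,2)] by blast
    obtain M where M: "\<And>M'. M \<le> M' \<Longrightarrow> box_extension i b r M' f F"
      using admissible_box.extension_imp_box_extension[OF adm[OF ibr(1)] ibr(2) bdd sep hol F] by blast
    obtain m :: nat where m: "max K M \<le> real m"
      using real_arch_simple by blast
    have "(real m)-lipschitz_on ((touching_box i b r \<inter> polydisc) \<union> frontier polydisc) F"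
      by (rule lipschitz_on_mono[OF lip]) (use m ibr in auto)
    then have "f \<in> L ((i, b, r), m)"
      using M m f by (auto simp: L_def lipschitz_box_extendable_def)
    then show "f \<in> (\<Union>p\<in>I. L p)"
      using ibr by (auto simp: I_def)
  next
    assume "f \<in> (\<Union>p\<in>I. L p)"
    then obtain i b r m where "(i, b, r) \<in> \<P>" "f \<in> lipschitz_box_extendable i b r (real m)"
      by (auto simp: I_def L_def)
    then show "\<exists>\<zeta>\<in>frontier polydisc. extendable_lipschitz f \<zeta>"
      using adm admissible_box.lipschitz_box_extendable_imp by blast
  qed
  have sep_eq: "?sep = topspace ?X - (\<Union>p\<in>I. C p)"
    by (rule nowhere_ext_eq_complement[OF sep_iff])
  have lip_eq: "?lip = topspace ?X - (\<Union>p\<in>I. L p)"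
    by (rule nowhere_ext_eq_complement[OF lip_iff])
  have "?X interior_of \<Union>(C ` I) = {}"
    by (rule Baire_category_alt) (use complete_boundary \<open>countable I\<close> closed in auto)
  then have dense_sep: "?X closure_of ?sep = topspace ?X"
    unfolding sep_eq closure_of_complement by simp
  have "gdelta_in ?X ?sep"
    unfolding sep_eq using \<open>countable I\<close> closed(1) by (rule gdelta_in_complement_countable_Union_closed)
  with dense_sep have sep: "dense_gdelta_in ?X ?sep"
    by (simp add: dense_gdelta_in_def)
  have "?sep \<subseteq> ?usual"
    using extendable_usual_imp_sep_cont unfolding nowhere_ext_def by blast
  then have usual: "residual_in ?X ?usual"
    using sep unfolding residual_in_def by (auto simp: nowhere_ext_def)
  have "?usual \<subseteq> ?lip"
    using extendable_lipschitz_imp_usual unfolding nowhere_ext_def by blast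
  with \<open>?sep \<subseteq> ?usual\<close> have "?X closure_of ?sep \<subseteq> ?X closure_of ?lip"
    by (intro closure_of_mono) simp
  then have dense_lip: "?X closure_of ?lip = topspace ?X"
    unfolding dense_sep by (intro subset_antisym closure_of_subset_topspace)
  have "gdelta_in ?X ?lip"
    unfolding lip_eq using \<open>countable I\<close> closed(3) by (rule gdelta_in_complement_countable_Union_closed)
  with dense_lip have "dense_gdelta_in ?X ?lip"
    by (simp add: dense_gdelta_in_def)
  with sep usual show ?thesis
    by blast
qed

end
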